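(* Let $k\ge n\ge 2$ be integers and let $s(n,k)=(k+n)(\log(k+n))^2$. Let $H\geq 1$ be a real number with $\log H\ge s(n,k)e^{s(n,k)}$. Define $$\omega(k,H)=k+\frac{k^2\log k}{\log\log H}\left(1+\frac{0.69}{\log k-1}\right)\quad\text{if } k\ge 5,$$ and $$\omega(k,H)=k+\frac{k^2\log k}{\log\log H}\,d(k)\quad\text{if } k\in\{2,3,4\},$$ where $d(2)=3.319$, $d(3)=1.145$, $d(4)=1.114$. Then for every real $r>\omega(k,H)$ and all $(\lambda_0,\ldots,\lambda_k)\in\mathbb{Z}^{k+1}\setminus\{(0,\ldots,0)\}$ with $\max_{1\le i\le k}|\lambda_i|\le H$, $$\left|\lambda_0+\lambda_1e^{1/n}+\lambda_2e^{2/n}+\cdots+\lambda_ke^{k/n}\right|>\frac{1}{H^r}.$$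
   Context: $\log$ denotes the natural logarithm. *)

theory Defs
  imports Complex_Main
begin

definition s_param :: "nat \<Rightarrow> nat \<Rightarrow> real" where
  "s_param n k = real (k + n) * (ln (real (k + n)))\<^sup>2"

(* Only the values at k = 2, 3, 4 are meaningful; the last branch is the value at k = 4. *)
definition d_const :: "nat \<Rightarrow> real" where
  "d_const k = (if k = 2 then 3.319 else if k = 3 then 1.145 else 1.114)"

(* Only used for k \<ge> 2. *)
definition omega :: "nat \<Rightarrow> real \<Rightarrow> real" where
  "omega k H =
     (if k \<ge> 5
      then real k + (real k)\<^sup>2 * ln (real k) / ln (ln H) * (1 + 0.69 / (ln (real k) - 1))
      else real k + (real k)\<^sup>2 * ln (real k) / ln (ln H) * d_const k)"

end

theory Submission
  imports Defs "HOL-Computational_Algebra.Polynomial" "HOL-Analysis.Harmonic_Numbers"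
begin

text \<open>
  The proof is Hermite's, made quantitative. For an integer polynomial \<open>f\<close> put
  \<open>F = f + n f' + n^2 f'' + \<dots>\<close>. Then \<open>F - n F' = f\<close>, so the derivative of \<open>exp (- x / n) F x\<close> is
  \<open>- exp (- x / n) f x / n\<close>, and the mean value theorem shows that \<open>F 0\<close> is a simultaneous
  approximate denominator of the numbers \<open>exp (j / n)\<close> with numerators \<open>F j\<close>
  (\<open>exp_times_deriv_series\<close>). For \<open>f\<close> one takes the product of \<open>(y - i)^(a + 1)\<close> over
  \<open>i = 0, \<dots>, k\<close>, with one factor \<open>y - u\<close> removed. The high order of vanishing at the integers makes
  every \<open>F j\<close> divisible by \<open>n^a a!\<close>; dividing by it gives the integers \<open>approximant n k a u j\<close>.

  Three properties of these integers matter.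

  \<^item> Modulo \<open>a + 1\<close> the matrix indexed by \<open>u\<close> and \<open>j\<close> is diagonal, and its diagonal entries are
    products of integers of absolute value at most \<open>k\<close>. If \<open>k! + 1\<close> divides \<open>a + 1\<close>, the matrix is
    therefore invertible modulo \<open>k! + 1\<close>, and for some \<open>u\<close> the integer
    \<open>\<Sum>j. l j * approximant n k a u j\<close> is nonzero (\<open>approximant_nonvanishing\<close>).

  \<^item> The errors are small, of size about \<open>(k! / 4)^a / (n^a a!)\<close> (\<open>approximant_remainder\<close>), because
    \<open>\<bar>x (x - 1) \<dots> (x - k)\<bar> \<le> k! / 4\<close> on \<open>[0, k]\<close>.

  \<^item> The common denominator is of size about \<open>n^(k a) (k + 1)^((k + 1) a) (a!)^k\<close>
    (\<open>approximant_0_le\<close>).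

  Hence, as soon as the total error, at most a constant (depending on \<open>k\<close>) times \<open>H (k! / 4)^a / (n^a a!)\<close>, is below
  \<open>1/2\<close>, the linear form is at least the reciprocal of twice the common denominator
  (\<open>linear_form_lower_bound\<close>). Let \<open>b\<close> be the last exponent for which the errors are still too
  large, and \<open>a\<close> the first suitable exponent after it (\<open>exponent_choice\<close>). Failure at \<open>b\<close> says that
  \<open>n^b b!\<close> is less than about \<open>H (k! / 4)^b\<close>, so the factor \<open>n^(k b) (b!)^k\<close> in the denominator costs \<open>H^k\<close>, and
  what remains is \<open>exp (b E)\<close> with \<open>E = (k + 1) ln (k + 1) + k ln (k! / 4)\<close>; the parameter \<open>n\<close>
  has cancelled. The same failure bounds \<open>b\<close> by roughly \<open>ln H / ln (ln H)\<close>, and the theorem becomes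
  the comparison of \<open>E\<close> with \<open>k^2 ln k\<close> times the stated constant, which is
  \<open>omega_factor_bound\<close>: separate numerical checks for \<open>k = 2, 3, 4\<close> and one polynomial inequality
  for \<open>k \<ge> 5\<close>. All lower-order terms, including the loss of up to \<open>k! + 1\<close> steps between \<open>b\<close> and
  \<open>a\<close>, are absorbed by the size of \<open>H\<close> (\<open>quadratic_le_exp\<close>).
\<close>

section \<open>Derivative series of integer polynomials and arithmetic of the approximations\<close>

definition deriv_series :: "nat \<Rightarrow> int poly \<Rightarrow> int poly" where
  "deriv_series n p = (\<Sum>m\<le>degree p. smult (int n ^ m) ((pderiv ^^ m) p))"

lemma smult_sum_right: "smult c (sum f A) = (\<Sum>i\<in>A. smult c (f i))"
  by (induction A rule: infinite_finite_induct) (simp_all add: smult_add_right)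

text \<open>The series telescopes: differentiating and multiplying by \<open>n\<close> shifts it by one term, and the
derivative of order \<open>degree p + 1\<close> vanishes.\<close>

lemma deriv_series_ode:
  "deriv_series n p = p + smult (int n) (pderiv (deriv_series n p))"
proof -
  let ?t = "\<lambda>m. smult (int n ^ m) ((pderiv ^^ m) p)"
  have top: "?t (Suc (degree p)) = 0"
  proof -
    have "degree ((pderiv ^^ degree p) p) = 0"
      by (simp add: degree_higher_pderiv)
    then show ?thesis
      by (simp add: pderiv_eq_0_iff)
  qed
  have "smult (int n) (pderiv (deriv_series n p)) = (\<Sum>m\<le>degree p. ?t (Suc m))"
    unfolding deriv_series_def
    by (simp add: higher_pderiv_sum[where n = 1, simplified] pderiv_smult smult_sum_right)
  also have "\<dots> = (\<Sum>m\<le>Suc (degree p). ?t m) - ?t 0"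
    by (subst sum.atMost_Suc_shift) simp
  also have "\<dots> = deriv_series n p - p"
    using top by (simp add: deriv_series_def)
  finally show ?thesis by simp
qed

text \<open>By Taylor's formula the value at \<open>c\<close> depends only on the coefficients of \<open>p\<close> expanded at \<open>c\<close>.
The upper limit is left free so that it can exceed the order of vanishing at \<open>c\<close> even if \<open>p\<close> is
the zero polynomial.\<close>

lemma poly_deriv_series:
  assumes "degree p \<le> N"
  shows "poly (deriv_series n p) c = (\<Sum>m\<le>N. int n ^ m * fact m * coeff (p \<circ>\<^sub>p [:c, 1:]) m)"
proof -
  have shift: "(pderiv ^^ m) (p \<circ>\<^sub>p [:c, 1:]) = (pderiv ^^ m) p \<circ>\<^sub>p [:c, 1:]" for m
    by (induction m) (simp_all add: pderiv_pcompose pderiv_pCons)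
  have "poly ((pderiv ^^ m) p) c = fact m * coeff (p \<circ>\<^sub>p [:c, 1:]) m" for m
  proof -
    have "poly ((pderiv ^^ m) p) c = coeff ((pderiv ^^ m) (p \<circ>\<^sub>p [:c, 1:])) 0"
      by (simp add: shift poly_0_coeff_0[symmetric] poly_pcompose)
    also have "\<dots> = fact m * coeff (p \<circ>\<^sub>p [:c, 1:]) m"
      by (simp add: coeff_higher_pderiv pochhammer_fact)
    finally show ?thesis .
  qed
  then have "poly (deriv_series n p) c
      = (\<Sum>m\<le>degree p. int n ^ m * fact m * coeff (p \<circ>\<^sub>p [:c, 1:]) m)"
    unfolding deriv_series_def by (simp add: poly_sum mult.assoc)
  also have "\<dots> = (\<Sum>m\<le>N. int n ^ m * fact m * coeff (p \<circ>\<^sub>p [:c, 1:]) m)"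
    by (rule sum.mono_neutral_left) (use assms in \<open>auto simp: coeff_eq_0 degree_pcompose\<close>)
  finally show ?thesis .
qed

text \<open>The source of all divisibility: at a zero of order \<open>e\<close> the Taylor coefficients below \<open>e\<close> vanish,
and every term above \<open>e\<close> carries the factor \<open>n^e (e + 1)!\<close>, hence is divisible by \<open>e + 1\<close> even
after the common factor \<open>n^e e!\<close> is removed.\<close>

lemma deriv_series_at_zero_of_order:
  assumes "p \<circ>\<^sub>p [:c, 1:] = [:0, 1:] ^ e * h"
  shows "\<exists>z. poly (deriv_series n p) c = int n ^ e * fact e * (coeff h 0 + int (e + 1) * z)"
proof -
  define N where "N = degree p + e"
  let ?q = "int n ^ e * fact (e + 1)"
  have cf: "coeff (p \<circ>\<^sub>p [:c, 1:]) m = (if m < e then 0 else coeff h (m - e))" for m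
    unfolding assms by (simp add: coeff_monom_mult monom_altdef[of 1, simplified, symmetric])
  have tail: "?q dvd int n ^ m * fact m * coeff (p \<circ>\<^sub>p [:c, 1:]) m" if "m \<noteq> e" for m
  proof (cases "m < e")
    case True
    then show ?thesis by (simp add: cf)
  next
    case False
    with that have "e + 1 \<le> m" by simp
    then have "int n ^ e dvd int n ^ m" "(fact (e + 1) :: int) dvd fact m"
      by (auto intro: le_imp_power_dvd simp del: fact_Suc simp: fact_dvd)
    then show ?thesis by (intro dvd_mult2 mult_dvd_mono)
  qed
  have "poly (deriv_series n p) c = (\<Sum>m\<le>N. int n ^ m * fact m * coeff (p \<circ>\<^sub>p [:c, 1:]) m)"
    by (rule poly_deriv_series) (simp add: N_def)
  also have "\<dots> = int n ^ e * fact e * coeff h 0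
      + (\<Sum>m\<in>{..N} - {e}. int n ^ m * fact m * coeff (p \<circ>\<^sub>p [:c, 1:]) m)"
    by (subst sum.remove[of _ e]) (auto simp: N_def cf)
  finally have "?q dvd poly (deriv_series n p) c - int n ^ e * fact e * coeff h 0"
    using tail by (auto simp del: fact_Suc intro!: dvd_sum)
  then obtain z where "poly (deriv_series n p) c - int n ^ e * fact e * coeff h 0 = ?q * z"
    by (rule dvdE)
  then have "poly (deriv_series n p) c = int n ^ e * fact e * (coeff h 0 + int (e + 1) * z)"
    by (simp add: algebra_simps)
  then show ?thesis by blast
qed

text \<open>The exponent is \<open>a + 1\<close> at every integer of \<open>{0..k}\<close> except \<open>u\<close>, where it is \<open>a\<close>.\<close>

definition hermite_poly :: "nat \<Rightarrow> nat \<Rightarrow> nat \<Rightarrow> int poly" where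
  "hermite_poly k a u = (\<Prod>i\<le>k. [:- int i, 1:]) ^ a * (\<Prod>i\<in>{..k} - {u}. [:- int i, 1:])"

definition approximant :: "nat \<Rightarrow> nat \<Rightarrow> nat \<Rightarrow> nat \<Rightarrow> nat \<Rightarrow> int" where
  "approximant n k a u j = poly (deriv_series n (hermite_poly k a u)) (int j) div (int n ^ a * fact a)"

text \<open>Modulo \<open>a + 1\<close> only the leading Taylor coefficient at \<open>j\<close> survives; for \<open>j \<noteq> u\<close> the order of
vanishing is \<open>a + 1\<close>, so the coefficient at order \<open>a\<close> is zero. The second part records that the
division in the definition of \<open>approximant\<close> is exact.\<close>

lemma approximant_residue:
  assumes "u \<le> k" "j \<le> k" "n > 0"
  shows "\<exists>z. approximant n k a u j
             = (if j = u then (\<Prod>i\<in>{..k} - {u}. int u - int i) ^ (a + 1) else 0) + int (a + 1) * z"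
    and "poly (deriv_series n (hermite_poly k a u)) (int j) = int n ^ a * fact a * approximant n k a u j"
proof -
  define h where "h = (\<Prod>i\<in>{..k} - {j}. [:int j - int i, 1:]) ^ a
      * (\<Prod>i\<in>{..k} - {u}. [:int j - int i, 1:])"
  have lin: "[:- int i, 1:] \<circ>\<^sub>p [:int j, 1:] = [:int j - int i, 1:]" for i
    by (simp add: pcompose_pCons)
  have split: "(\<Prod>i\<le>k. [:int j - int i, 1:]) = [:0, 1:] * (\<Prod>i\<in>{..k} - {j}. [:int j - int i, 1:])"
    by (subst prod.remove[of _ j]) (use assms in auto)
  have pw: "(p ^ m) \<circ>\<^sub>p r = (p \<circ>\<^sub>p r) ^ m" for p r :: "int poly" and m
    by (induction m) (simp_all add: pcompose_mult pcompose_1)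
  have "hermite_poly k a u \<circ>\<^sub>p [:int j, 1:] = [:0, 1:] ^ a * h"
    unfolding hermite_poly_def h_def
    by (simp only: pcompose_mult pw pcompose_prod lin split power_mult_distrib mult.assoc)
  then obtain z where z: "poly (deriv_series n (hermite_poly k a u)) (int j)
      = int n ^ a * fact a * (coeff h 0 + int (a + 1) * z)"
    using deriv_series_at_zero_of_order by blast
  have h0: "coeff h 0 = (\<Prod>i\<in>{..k} - {j}. int j - int i) ^ a * (\<Prod>i\<in>{..k} - {u}. int j - int i)"
    unfolding h_def by (simp add: poly_0_coeff_0[symmetric] poly_prod)
  have "(\<Prod>i\<in>{..k} - {u}. int j - int i) = 0" if "j \<noteq> u"
    using that assms by (intro prod_zero) auto
  then have "coeff h 0 = (if j = u then (\<Prod>i\<in>{..k} - {u}. int u - int i) ^ (a + 1) else 0)"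
    unfolding h0 by (auto simp: mult.commute)
  moreover have app: "approximant n k a u j = coeff h 0 + int (a + 1) * z"
    unfolding approximant_def z using assms by simp
  ultimately show "\<exists>z. approximant n k a u j
             = (if j = u then (\<Prod>i\<in>{..k} - {u}. int u - int i) ^ (a + 1) else 0) + int (a + 1) * z"
    by (intro exI[of _ z]) simp
  show "poly (deriv_series n (hermite_poly k a u)) (int j) = int n ^ a * fact a * approximant n k a u j"
    unfolding app by (rule z)
qed

text \<open>The modulus \<open>q = k! + 1\<close> is coprime to all nonzero integers of absolute value at most \<open>k\<close>, hence
to the diagonal entries, while it divides the entries off the diagonal. If all the sums were zero,
then row \<open>u\<close> would force \<open>q\<close> to divide \<open>l u\<close>; dividing the whole relation by \<open>q\<close> and repeating, every
power of \<open>q\<close> would divide every \<open>l u\<close>.\<close>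

lemma approximant_nonvanishing:
  fixes l :: "nat \<Rightarrow> int"
  assumes "n > 0" "fact k + 1 dvd a + 1" "i0 \<le> k" "l i0 \<noteq> 0"
  shows "\<exists>u\<le>k. (\<Sum>j\<le>k. l j * approximant n k a u j) \<noteq> 0"
proof (rule ccontr)
  assume "\<not> ?thesis"
  then have rel: "(\<Sum>j\<le>k. l j * approximant n k a u j) = 0" if "u \<le> k" for u
    using that by blast
  define q :: int where "q = fact k + 1"
  have q1: "q > 1" by (simp add: q_def)
  have qdvd: "q dvd int (a + 1)"
    using assms(2) unfolding q_def by (metis of_nat_1 of_nat_add of_nat_dvd_iff of_nat_fact)
  have off: "q dvd approximant n k a u j" if "u \<le> k" "j \<le> k" "j \<noteq> u" for u j
    using approximant_residue(1)[of u k j n a] that assms(1) qdvd by auto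
  have diag: "coprime q (approximant n k a u u)" if "u \<le> k" for u
  proof -
    obtain z where z: "approximant n k a u u
        = (\<Prod>i\<in>{..k} - {u}. int u - int i) ^ (a + 1) + int (a + 1) * z"
      using approximant_residue(1)[OF \<open>u \<le> k\<close> \<open>u \<le> k\<close> assms(1), of a] by (auto simp only: simp_thms if_True)
    have "coprime q (int u - int i)" if i: "i \<in> {..k} - {u}" for i
    proof -
      have "nat \<bar>int u - int i\<bar> dvd fact k"
        using i \<open>u \<le> k\<close> by (intro dvd_fact) auto
      then have "int (nat \<bar>int u - int i\<bar>) dvd int (fact k)"
        by (simp only: of_nat_dvd_iff)
      then have "int u - int i dvd fact k"
        by simp
      moreover have "coprime q (fact k)"
        unfolding q_def by (simp add: coprime_add_one_left)
      ultimately show ?thesis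
        by (meson coprime_divisors dvd_refl)
    qed
    then have "coprime q ((\<Prod>i\<in>{..k} - {u}. int u - int i) ^ (a + 1))"
      by (intro coprime_power_right_iff[THEN iffD2] disjI1 prod_coprime_right) auto
    moreover obtain c where "int (a + 1) = q * c" using qdvd by blast
    ultimately show ?thesis
      unfolding z by (simp add: coprime_iff_gcd_eq_1 mult.assoc gcd_add_mult add.commute)
        (metis gcd_add_mult mult.commute)
  qed
  \<comment> \<open>The descent: each step extracts one more factor \<open>q\<close> from all coefficients.\<close>
  have div_all: "\<forall>j\<le>k. q ^ N dvd l j" for N
  proof (induction N)
    case 0
    then show ?case by simp
  next
    case (Suc N)
    then have "\<forall>j\<le>k. \<exists>m. l j = q ^ N * m" by (meson dvdE)
    then obtain m where m: "\<And>j. j \<le> k \<Longrightarrow> l j = q ^ N * m j" by metis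
    show ?case
    proof (intro allI impI)
      fix u assume u: "u \<le> k"
      have "0 = (\<Sum>j\<le>k. q ^ N * (m j * approximant n k a u j))"
        using rel[OF u] m by (simp add: mult.assoc)
      then have "q ^ N * (\<Sum>j\<le>k. m j * approximant n k a u j) = 0"
        by (simp add: sum_distrib_left)
      then have "(\<Sum>j\<le>k. m j * approximant n k a u j) = 0"
        using q1 by simp
      then have "m u * approximant n k a u u
          = - (\<Sum>j\<in>{..k} - {u}. m j * approximant n k a u j)"
        using u by (subst (asm) sum.remove[of _ u]) auto
      also have "q dvd \<dots>"
        using off u by (auto intro!: dvd_sum intro: dvd_mult)
      finally have "q dvd m u"
        using diag[OF u] by (simp add: coprime_dvd_mult_left_iff)
      then show "q ^ Suc N dvd l u"
        using m[OF u] by (simp add: mult.commute mult_dvd_mono)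
    qed
  qed
  define N where "N = nat \<bar>l i0\<bar>"
  have "q ^ N dvd l i0" using div_all assms(3) by blast
  then have "q ^ N \<le> \<bar>l i0\<bar>"
    using assms(4) by (metis abs_ge_self dvd_abs_iff dvd_imp_le_int order_trans)
  moreover have "int N < q ^ N"
  proof -
    have "int N < 2 ^ N" by (metis of_nat_less_two_power)
    also have "\<dots> \<le> q ^ N" using q1 by (intro power_mono) auto
    finally show ?thesis .
  qed
  ultimately show False by (simp add: N_def)
qed

section \<open>Analytic size of the approximations\<close>

text \<open>A norm that dominates the value of the derivative series at 0. It equals the integral of
\<open>exp (- t) q (n t)\<close> over \<open>t \<ge> 0\<close>, where \<open>q\<close> is \<open>p\<close> with its coefficients (up to degree \<open>N\<close>)
replaced by their absolute values.\<close>

definition fact_norm :: "nat \<Rightarrow> nat \<Rightarrow> int poly \<Rightarrow> int" where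
  "fact_norm n N p = (\<Sum>m\<le>N. int n ^ m * fact m * \<bar>coeff p m\<bar>)"

lemma deriv_series_at_0_le_fact_norm:
  assumes "degree p \<le> N"
  shows "\<bar>poly (deriv_series n p) 0\<bar> \<le> fact_norm n N p"
proof -
  have "p \<circ>\<^sub>p [:0, 1:] = p" by simp
  then have "\<bar>poly (deriv_series n p) 0\<bar> = \<bar>\<Sum>m\<le>N. int n ^ m * fact m * coeff p m\<bar>"
    using poly_deriv_series[OF assms, of n 0] by simp
  also have "\<dots> \<le> (\<Sum>m\<le>N. \<bar>int n ^ m * fact m * coeff p m\<bar>)" by (rule sum_abs)
  finally show ?thesis by (simp add: fact_norm_def abs_mult)
qed

text \<open>Multiplication by the variable raises each degree by one and so costs at most \<open>n (N + 1)\<close>;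
multiplication by the constant costs \<open>\<bar>c\<bar>\<close>.\<close>

lemma fact_norm_linear_factor:
  assumes "degree p \<le> N"
  shows "fact_norm n (Suc N) ([:- c, 1:] * p) \<le> (int n * int (Suc N) + \<bar>c\<bar>) * fact_norm n N p"
proof -
  let ?w = "\<lambda>m. int n ^ m * fact m :: int"
  define s where "s m = (case m of 0 \<Rightarrow> 0 | Suc i \<Rightarrow> coeff p i)" for m
  have cf: "coeff ([:- c, 1:] * p) m = - c * coeff p m + s m" for m
    by (cases m) (simp_all add: s_def)
  have "fact_norm n (Suc N) ([:- c, 1:] * p)
      \<le> (\<Sum>m\<le>Suc N. \<bar>c\<bar> * (?w m * \<bar>coeff p m\<bar>) + ?w m * \<bar>s m\<bar>)"
    unfolding fact_norm_def
  proof (rule sum_mono)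
    fix m
    have "\<bar>coeff ([:- c, 1:] * p) m\<bar> \<le> \<bar>c\<bar> * \<bar>coeff p m\<bar> + \<bar>s m\<bar>"
      unfolding cf by (metis abs_minus_cancel abs_mult abs_triangle_ineq)
    then have "?w m * \<bar>coeff ([:- c, 1:] * p) m\<bar> \<le> ?w m * (\<bar>c\<bar> * \<bar>coeff p m\<bar> + \<bar>s m\<bar>)"
      by (intro mult_left_mono) simp_all
    then show "?w m * \<bar>coeff ([:- c, 1:] * p) m\<bar> \<le> \<bar>c\<bar> * (?w m * \<bar>coeff p m\<bar>) + ?w m * \<bar>s m\<bar>"
      by (simp only: algebra_simps)
  qed
  also have "\<dots> = \<bar>c\<bar> * (\<Sum>m\<le>Suc N. ?w m * \<bar>coeff p m\<bar>) + (\<Sum>m\<le>Suc N. ?w m * \<bar>s m\<bar>)"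
    by (simp only: sum.distrib sum_distrib_left)
  also have "(\<Sum>m\<le>Suc N. ?w m * \<bar>coeff p m\<bar>) = fact_norm n N p"
    using assms by (simp add: fact_norm_def coeff_eq_0)
  also have "(\<Sum>m\<le>Suc N. ?w m * \<bar>s m\<bar>) = (\<Sum>m\<le>N. ?w (Suc m) * \<bar>coeff p m\<bar>)"
    by (subst sum.atMost_Suc_shift) (simp add: s_def)
  also have "\<dots> \<le> (\<Sum>m\<le>N. int n * int (Suc N) * (?w m * \<bar>coeff p m\<bar>))"
  proof (rule sum_mono)
    fix m assume "m \<in> {..N}"
    then have "int n * int (Suc m) * (?w m * \<bar>coeff p m\<bar>)
        \<le> int n * int (Suc N) * (?w m * \<bar>coeff p m\<bar>)"
      by (intro mult_right_mono mult_left_mono) simp_all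
    then show "?w (Suc m) * \<bar>coeff p m\<bar> \<le> int n * int (Suc N) * (?w m * \<bar>coeff p m\<bar>)"
      by (simp add: mult_ac)
  qed
  also have "\<dots> = int n * int (Suc N) * fact_norm n N p"
    by (simp only: fact_norm_def sum_distrib_left)
  finally show ?thesis by (simp add: algebra_simps)
qed

text \<open>The shifted factorial \<open>(N + k)!\<close> makes the bound stable under further linear factors: for \<open>c \<le> k\<close>
and \<open>n \<ge> 1\<close>, \<open>n (N + 1) + c \<le> n (N + 1 + k)\<close>. Compared with \<open>N!\<close> this loses a factor of at most
\<open>(N + k)^k\<close>, which is of lower order.\<close>

lemma fact_norm_prod_linear:
  assumes "finite A" "\<And>i. i \<in> A \<Longrightarrow> i \<le> k" "n > 0"
    and "degree p \<le> N" "fact_norm n N p \<le> int n ^ N * fact (N + k)"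
  shows "degree ((\<Prod>i\<in>A. [:- int i, 1:]) * p) \<le> N + card A"
    and "fact_norm n (N + card A) ((\<Prod>i\<in>A. [:- int i, 1:]) * p)
          \<le> int n ^ (N + card A) * fact (N + card A + k)"
  using assms
proof (induction A rule: finite_induct)
  case empty
  {
    case 1
    then show ?case by simp
  next
    case 2
    then show ?case by simp
  }
next
  case (insert c A)
  let ?P = "(\<Prod>i\<in>A. [:- int i, 1:]) * p" and ?M = "N + card A"
  have eq: "(\<Prod>i\<in>insert c A. [:- int i, 1:]) * p = [:- int c, 1:] * ?P"
    by (simp only: prod.insert[OF insert.hyps] mult.assoc)
  have card: "N + card (insert c A) = Suc ?M" using insert.hyps by simp
  {
    case 1
    then have "degree ?P \<le> ?M" using insert.IH(1) by auto
    moreover have "degree ([:- int c, 1:] * ?P) \<le> 1 + degree ?P"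
      by (rule order_trans[OF degree_mult_le]) simp
    ultimately show ?case unfolding eq card by simp
  next
    case 2
    have d: "degree ?P \<le> ?M" using insert.IH(1) 2 by auto
    have b: "fact_norm n ?M ?P \<le> int n ^ ?M * fact (?M + k)" using insert.IH(2) 2 by auto
    have ck: "c \<le> k" using 2 by simp
    have "int c \<le> int n * int k"
      using ck 2 by (metis mult_le_mono nat_mult_1 of_nat_le_iff of_nat_mult Suc_leI One_nat_def)
    then have fac: "int n * int (Suc ?M) + \<bar>int c\<bar> \<le> int n * int (Suc ?M + k)"
      by (simp add: algebra_simps)
    have "fact_norm n (Suc ?M) ([:- int c, 1:] * ?P)
        \<le> (int n * int (Suc ?M) + \<bar>int c\<bar>) * fact_norm n ?M ?P"
      by (rule fact_norm_linear_factor[OF d])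
    also have "\<dots> \<le> (int n * int (Suc ?M + k)) * (int n ^ ?M * fact (?M + k))"
      by (rule mult_mono[OF fac b]) (auto simp: fact_norm_def intro!: sum_nonneg)
    also have "\<dots> = int n ^ Suc ?M * fact (Suc ?M + k)"
      by (simp add: algebra_simps)
    finally show ?case unfolding eq card .
  }
qed

lemma hermite_poly_fact_norm:
  fixes a k n u :: nat
  assumes "u \<le> k" "n > 0"
  defines "L \<equiv> (k + 1) * a + k"
  shows "degree (hermite_poly k a u) \<le> L"
    and "fact_norm n L (hermite_poly k a u) \<le> int n ^ L * fact (L + k)"
proof -
  let ?Q = "\<Prod>i\<le>k. [:- int i, 1:]" and ?R = "\<Prod>i\<in>{..k} - {u}. [:- int i, 1:]"
  have base: "degree (?R * 1) \<le> 0 + k \<and> fact_norm n (0 + k) (?R * 1) \<le> int n ^ (0 + k) * fact (0 + k + k)"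
  proof -
    have card: "card ({..k} - {u}) = k" using assms by simp
    have one: "fact_norm n 0 1 \<le> int n ^ 0 * fact (0 + k)" by (simp add: fact_norm_def)
    have fin: "finite ({..k} - {u})" and le: "\<And>i. i \<in> {..k} - {u} \<Longrightarrow> i \<le> k"
      and deg: "degree (1 :: int poly) \<le> 0" by auto
    show ?thesis
      using fact_norm_prod_linear[OF fin le assms(2) deg one, unfolded card] by blast
  qed
  have "degree (?Q ^ a * ?R) \<le> (k + 1) * a + k \<and>
      fact_norm n ((k + 1) * a + k) (?Q ^ a * ?R) \<le> int n ^ ((k + 1) * a + k) * fact ((k + 1) * a + k + k)"
  proof (induction a)
    case 0
    then show ?case using base by simp
  next
    case (Suc a)
    have eq: "(k + 1) * Suc a + k = (k + 1) * a + k + card {..k}" by simp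
    have fin: "finite {..k}" and le: "\<And>i. i \<in> {..k} \<Longrightarrow> i \<le> k" by auto
    show ?case
      unfolding eq power_Suc mult.assoc[of ?Q]
      using fact_norm_prod_linear[OF fin le assms(2) conjunct1[OF Suc] conjunct2[OF Suc]] by blast
  qed
  then show "degree (hermite_poly k a u) \<le> L"
    and "fact_norm n L (hermite_poly k a u) \<le> int n ^ L * fact (L + k)"
    unfolding hermite_poly_def L_def by auto
qed

abbreviation real_eval :: "int poly \<Rightarrow> real \<Rightarrow> real" where
  "real_eval p \<equiv> poly (map_poly real_of_int p)"

lemma real_eval_of_int: "real_eval p (of_int c) = of_int (poly p c)"
  by (induction p) (simp_all add: map_poly_pCons)

lemma real_eval_mult: "real_eval (p * q) x = real_eval p x * real_eval q x"
proof -
  have "map_poly real_of_int (p * q) = map_poly of_int p * map_poly of_int q"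
    by (intro poly_eqI) (simp add: coeff_map_poly coeff_mult)
  then show ?thesis by simp
qed

lemma real_eval_power: "real_eval (p ^ m) x = real_eval p x ^ m"
  by (induction m) (simp_all add: real_eval_mult)

lemma real_eval_prod: "real_eval (prod f A) x = (\<Prod>i\<in>A. real_eval (f i) x)"
  by (induction A rule: infinite_finite_induct) (simp_all add: real_eval_mult)

text \<open>The mean value theorem for \<open>exp (- x / n) F x\<close> on \<open>[0, j]\<close>, where \<open>F\<close> is the derivative series of \<open>p\<close>.\<close>

lemma exp_times_deriv_series:
  assumes "n > 0" "j > 0" "\<And>x. 0 \<le> x \<Longrightarrow> x \<le> real j \<Longrightarrow> \<bar>real_eval p x\<bar> \<le> B"
  shows "\<bar>exp (real j / real n) * of_int (poly (deriv_series n p) 0)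
           - of_int (poly (deriv_series n p) (int j))\<bar> \<le> real j / real n * exp (real j / real n) * B"
proof -
  define F where "F = deriv_series n p"
  define P where "P = map_poly real_of_int F"
  define g where "g x = exp (- x / real n) * poly P x" for x
  have "P = map_poly real_of_int p + smult (real n) (pderiv P)"
    unfolding P_def F_def by (subst deriv_series_ode, intro poly_eqI) (simp add: coeff_map_poly coeff_pderiv)
  then have ode: "poly P x = real_eval p x + real n * poly (pderiv P) x" for x
    by (metis poly_add poly_smult)
  have der: "DERIV g x :> - (exp (- x / real n) * real_eval p x / real n)" for x
  proof -
    have "DERIV g x :> exp (- x / real n) * (- 1 / real n) * poly P x + poly (pderiv P) x * exp (- x / real n)"
      unfolding g_def using assms(1) by (auto intro!: derivative_eq_intros poly_DERIV)
    also have "exp (- x / real n) * (- 1 / real n) * poly P x + poly (pderiv P) x * exp (- x / real n)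
        = - (exp (- x / real n) * real_eval p x / real n)"
      using assms(1) by (simp add: ode field_simps)
    finally show ?thesis .
  qed
  obtain z where z: "0 < z" "z < real j"
    and gz: "g (real j) - g 0 = (real j - 0) * - (exp (- z / real n) * real_eval p z / real n)"
    using MVT2[of 0 "real j" g "\<lambda>x. - (exp (- x / real n) * real_eval p x / real n)"] der assms(2) by auto
  have inv: "exp (real j / real n) * exp (- real j / real n) = 1"
    by (simp flip: exp_add)
  have "exp (real j / real n) * of_int (poly F 0) - of_int (poly F (int j))
      = exp (real j / real n) * (g 0 - g (real j))"
    using real_eval_of_int[of F 0] real_eval_of_int[of F "int j"]
    by (simp add: g_def P_def right_diff_distrib mult.assoc[symmetric] inv[simplified])
  also have "g 0 - g (real j) = real j / real n * (exp (- z / real n) * real_eval p z)"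
    using gz by (simp add: algebra_simps)
  also have "exp (real j / real n) * \<dots> = real j / real n * exp (real j / real n) * (exp (- z / real n) * real_eval p z)"
    by (simp only: mult_ac)
  finally have eq: "exp (real j / real n) * of_int (poly F 0) - of_int (poly F (int j))
      = real j / real n * exp (real j / real n) * (exp (- z / real n) * real_eval p z)" .
  have "\<bar>exp (- z / real n) * real_eval p z\<bar> \<le> 1 * B"
    unfolding abs_mult using assms z by (intro mult_mono) auto
  then show ?thesis
    unfolding F_def[symmetric] eq abs_mult by (intro mult_mono) auto
qed

text \<open>Induction on \<open>k\<close>. The new factor is at most \<open>k + 1\<close> on \<open>[0, k]\<close>; the missing interval \<open>[k, k + 1]\<close> is
the mirror image of \<open>[0, 1]\<close> under \<open>x \<mapsto> k + 1 - x\<close>. The gain of the factor 4 over \<open>k!\<close> is what makes the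
numerical comparison succeed for \<open>k = 3\<close>.\<close>

lemma prod_dist_le:
  assumes "k \<ge> 1" "0 \<le> x" "x \<le> real k"
  shows "(\<Prod>i\<le>k. \<bar>x - real i\<bar>) \<le> fact k / 4"
  using assms
proof (induction k arbitrary: x rule: nat_induct_at_least)
  case base
  have "x * (1 - x) \<le> 1 / 4"
    using sum_squares_ge_zero[of "x - 1/2" 0] by (simp add: algebra_simps power2_eq_square)
  moreover have "(\<Prod>i\<le>1. \<bar>x - real i\<bar>) = x * (1 - x)"
    using base by (simp add: atMost_Suc)
  ultimately show ?case by simp
next
  case (Suc k)
  have low: "(\<Prod>i\<le>Suc k. \<bar>y - real i\<bar>) \<le> fact (Suc k) / 4" if "0 \<le> y" "y \<le> real k" for y
  proof -
    have "(\<Prod>i\<le>Suc k. \<bar>y - real i\<bar>) = (\<Prod>i\<le>k. \<bar>y - real i\<bar>) * \<bar>y - real (Suc k)\<bar>" by simp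
    also have "\<dots> \<le> fact k / 4 * real (Suc k)"
      using that by (intro mult_mono Suc.IH) auto
    finally show ?thesis by (simp add: algebra_simps)
  qed
  show ?case
  proof (cases "x \<le> real k")
    case True
    then show ?thesis using low Suc.prems by blast
  next
    case False
    have "(\<Prod>i\<le>Suc k. \<bar>x - real i\<bar>) = (\<Prod>i\<le>Suc k. \<bar>x - real (Suc k - i)\<bar>)"
      by (rule prod.reindex_bij_witness[where i = "\<lambda>i. Suc k - i" and j = "\<lambda>i. Suc k - i"]) auto
    also have "\<dots> = (\<Prod>i\<le>Suc k. \<bar>(real (Suc k) - x) - real i\<bar>)"
      by (intro prod.cong) (auto simp: of_nat_diff)
    also have "\<dots> \<le> fact (Suc k) / 4"
      using False Suc.prems Suc.hyps by (intro low) auto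
    finally show ?thesis .
  qed
qed

lemma real_eval_hermite_poly_le:
  assumes "k \<ge> 1" "u \<le> k" "0 \<le> x" "x \<le> real k"
  shows "\<bar>real_eval (hermite_poly k a u) x\<bar> \<le> (fact k / 4) ^ a * real k ^ k"
proof -
  have lin: "real_eval [:- int i, 1:] x = x - real i" for i by (simp add: map_poly_pCons)
  have "\<bar>real_eval (hermite_poly k a u) x\<bar>
      = (\<Prod>i\<le>k. \<bar>x - real i\<bar>) ^ a * (\<Prod>i\<in>{..k} - {u}. \<bar>x - real i\<bar>)"
    unfolding hermite_poly_def real_eval_mult real_eval_power real_eval_prod lin by (simp add: abs_mult power_abs abs_prod)
  also have "\<dots> \<le> (fact k / 4) ^ a * real k ^ k"
  proof (intro mult_mono power_mono prod_dist_le assms)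
    have "(\<Prod>i\<in>{..k} - {u}. \<bar>x - real i\<bar>) \<le> (\<Prod>i\<in>{..k} - {u}. real k)"
      using assms by (intro prod_mono) auto
    then show "(\<Prod>i\<in>{..k} - {u}. \<bar>x - real i\<bar>) \<le> real k ^ k" using assms by simp
  qed (auto intro!: prod_nonneg zero_le_power)
  finally show ?thesis .
qed

lemma approximant_remainder:
  assumes "n \<ge> 2" "u \<le> k" "j \<le> k"
  shows "\<bar>exp (real j / real n) * of_int (approximant n k a u 0) - of_int (approximant n k a u j)\<bar>
    \<le> real k / 2 * exp (real k / 2) * real k ^ k * (fact k / 4) ^ a / (real n ^ a * fact a)"
proof (cases "j = 0")
  case True
  then show ?thesis by simp
next
  case False
  let ?D = "real n ^ a * fact a" and ?B = "(fact k / 4) ^ a * real k ^ k"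
  let ?F = "deriv_series n (hermite_poly k a u)"
  have D: "?D > 0" using assms by simp
  have div: "real_of_int (poly ?F (int i)) = ?D * of_int (approximant n k a u i)" if "i \<le> k" for i
    using approximant_residue(2)[of u k i n a] assms that by simp
  have jn: "real j / real n \<le> real k / 2"
    using assms by (intro frac_le) auto
  have "\<bar>exp (real j / real n) * of_int (poly ?F 0) - of_int (poly ?F (int j))\<bar>
      \<le> real j / real n * exp (real j / real n) * ?B"
    using assms False by (intro exp_times_deriv_series real_eval_hermite_poly_le) auto
  also have "\<dots> \<le> real k / 2 * exp (real k / 2) * ?B"
    using jn by (intro mult_mono) auto
  also have "exp (real j / real n) * of_int (poly ?F 0) - of_int (poly ?F (int j))
      = ?D * (exp (real j / real n) * of_int (approximant n k a u 0) - of_int (approximant n k a u j))"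
    using div[of 0] div[of j] assms by (simp add: algebra_simps)
  also have "\<bar>\<dots>\<bar> = ?D * \<bar>exp (real j / real n) * of_int (approximant n k a u 0) - of_int (approximant n k a u j)\<bar>"
    using D by (simp add: abs_mult)
  finally show ?thesis by (subst pos_le_divide_eq[OF D]) (simp only: mult_ac)
qed

text \<open>The multinomial coefficient \<open>(m a)! / (a!)^m\<close> is at most \<open>m^(m a)\<close>. Using this in place of
Stirling's formula keeps the powers of \<open>a!\<close> exact, so that they can later be traded for \<open>H\<close>.\<close>

lemma fact_mult_le: "fact (m * a) \<le> m ^ (m * a) * (fact a ^ m :: nat)"
proof (induction m)
  case 0
  then show ?case by simp
next
  case (Suc m)
  have "(Suc m * a choose m * a) * m ^ (m * a) \<le> (\<Sum>i\<le>Suc m * a. (Suc m * a choose i) * m ^ i)"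
    by (rule member_le_sum) auto
  also have "\<dots> = Suc m ^ (Suc m * a)"
    using binomial[of m 1 "Suc m * a"] by simp
  finally have binom: "(Suc m * a choose m * a) * m ^ (m * a) \<le> Suc m ^ (Suc m * a)" .
  have "fact (Suc m * a) = fact (m * a) * fact a * (Suc m * a choose m * a)"
    using binomial_fact_lemma[of "m * a" "Suc m * a"] by simp
  also have "\<dots> \<le> (m ^ (m * a) * fact a ^ m) * fact a * (Suc m * a choose m * a)"
    using Suc by (intro mult_le_mono) auto
  also have "\<dots> = ((Suc m * a choose m * a) * m ^ (m * a)) * fact a ^ Suc m"
    by (simp add: algebra_simps)
  also have "\<dots> \<le> Suc m ^ (Suc m * a) * fact a ^ Suc m"
    using binom by (intro mult_le_mono) auto
  finally show ?case .
qed

text \<open>The degree is \<open>L = (k + 1) a + k\<close>, so the norm bound is \<open>n^L ((k + 1) a + 2 k)!\<close>; dividing by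
\<open>n^a a!\<close> and using the multinomial bound leaves \<open>(a!)^k\<close>.\<close>

lemma approximant_0_le:
  assumes "u \<le> k" "n > 0"
  shows "\<bar>real_of_int (approximant n k a u 0)\<bar>
    \<le> real n ^ (k * a + k) * real (k + 1) ^ ((k + 1) * a) * fact a ^ k * real ((k + 1) * a + 2 * k) ^ (2 * k)"
proof -
  let ?D = "real n ^ a * fact a" and ?L = "(k + 1) * a + k"
  let ?F = "deriv_series n (hermite_poly k a u)"
  have D: "?D > 0" using assms by simp
  have "real_of_int (poly ?F 0) = ?D * of_int (approximant n k a u 0)"
    using approximant_residue(2)[of u k 0 n a] assms by simp
  moreover have "\<bar>poly ?F 0\<bar> \<le> int n ^ ?L * fact (?L + k)"
    using deriv_series_at_0_le_fact_norm[OF hermite_poly_fact_norm(1)[OF assms(1,2)]]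
      hermite_poly_fact_norm(2)[OF assms(1,2)] by (rule order_trans)
  then have "\<bar>real_of_int (poly ?F 0)\<bar> \<le> real n ^ ?L * fact (?L + k)"
  proof -
    have "real_of_int \<bar>poly ?F 0\<bar> \<le> real_of_int (int n ^ ?L * fact (?L + k))"
      using \<open>\<bar>poly ?F 0\<bar> \<le> _\<close> by (simp only: of_int_le_iff)
    then show ?thesis by simp
  qed
  ultimately have 1: "?D * \<bar>real_of_int (approximant n k a u 0)\<bar> \<le> real n ^ ?L * fact (?L + k)"
    using D by (simp add: abs_mult)
  have "(fact (?L + k) :: nat) \<le> fact ((k + 1) * a) * (?L + k) ^ (2 * k)"
  proof -
    have "?L + k - 2 * k = (k + 1) * a" by simp
    then have "fact (?L + k) div fact ((k + 1) * a) \<le> (?L + k) ^ (2 * k)"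
      using fact_div_fact_le_pow[of "2 * k" "?L + k"] by (simp add: mult_2)
    moreover have "(fact ((k + 1) * a) :: nat) dvd fact (?L + k)" by (rule fact_dvd) simp
    ultimately show ?thesis
      by (metis dvd_mult_div_cancel mult_le_mono2)
  qed
  also have "\<dots> \<le> (k + 1) ^ ((k + 1) * a) * fact a ^ (k + 1) * (?L + k) ^ (2 * k)"
    using fact_mult_le[of "k + 1" a] by (intro mult_le_mono) auto
  finally have "real (fact (?L + k)) \<le> real ((k + 1) ^ ((k + 1) * a) * fact a ^ (k + 1) * (?L + k) ^ (2 * k))"
    by (simp only: of_nat_le_iff)
  then have 2: "fact (?L + k) \<le> real (k + 1) ^ ((k + 1) * a) * fact a ^ (k + 1) * real ((k + 1) * a + 2 * k) ^ (2 * k)"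
  proof -
    have "?L + k = (k + 1) * a + 2 * k" by simp
    then show ?thesis
      using \<open>real (fact (?L + k)) \<le> _\<close> by (simp only: of_nat_mult of_nat_power of_nat_fact)
  qed
  have n_pow: "real n ^ ?L = real n ^ a * real n ^ (k * a + k)"
    by (subst power_add[symmetric]) (simp add: algebra_simps)
  have a_pow: "(fact a :: real) ^ (k + 1) = fact a * fact a ^ k" by simp
  have "?D * \<bar>real_of_int (approximant n k a u 0)\<bar>
      \<le> real n ^ ?L * (real (k + 1) ^ ((k + 1) * a) * fact a ^ (k + 1) * real ((k + 1) * a + 2 * k) ^ (2 * k))"
    by (rule order_trans[OF 1]) (intro mult_left_mono 2, simp)
  also have "\<dots> = ?D * (real n ^ (k * a + k) * real (k + 1) ^ ((k + 1) * a) * fact a ^ k * real ((k + 1) * a + 2 * k) ^ (2 * k))"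
    unfolding n_pow a_pow by (simp only: mult_ac)
  finally show ?thesis using D by (simp only: mult_le_cancel_left_pos)
qed

section \<open>Numerical inequality behind the transcendence measure\<close>

lemma ln2_bounds: "0.693 \<le> ln (2::real)" "ln (2::real) \<le> 0.6932"
  using ln_approx_bounds[of 2 4] by (simp_all add: eval_nat_numeral)

lemma ln3_bounds: "1.0986 \<le> ln (3::real)" "ln (3::real) \<le> 1.0987"
  using ln_approx_bounds[of 3 7] by (simp_all add: eval_nat_numeral)

lemma ln5_bounds: "1.609 \<le> ln (5::real)" "ln (5::real) \<le> 1.6095"
proof -
  have "ln (5/4::real) = ln 5 - 2 * ln 2"
    using ln_realpow[of 2 2] by (simp add: ln_div)
  moreover have "0.2231 \<le> ln (5/4::real)" "ln (5/4::real) \<le> 0.2232"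
    using ln_approx_bounds[of "5/4" 2] by (simp_all add: eval_nat_numeral)
  moreover have "0.69314 \<le> ln (2::real)" "ln (2::real) \<le> 0.69315"
    using ln_approx_bounds[of 2 6] by (simp_all add: eval_nat_numeral)
  ultimately show "1.609 \<le> ln (5::real)" "ln (5::real) \<le> 1.6095" by simp_all
qed

lemma ln_le_tangent:
  fixes x w :: real
  assumes "w > 0" "x > 0"
  shows "ln x \<le> ln w + x / w - 1"
  using ln_le_minus_one[of "x / w"] assms by (simp add: ln_div)

text \<open>A weak form of Stirling's upper bound. The term \<open>- k\<close> matters: it offsets the loss in replacing
\<open>ln b\<close> by \<open>ln (ln H)\<close> for large \<open>k\<close>.\<close>

lemma ln_fact_le:
  assumes "k \<ge> 1"
  shows "ln (fact k :: real) \<le> real (k + 1) * ln (real k) - real k + 1"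
  using assms
proof (induction k rule: nat_induct_at_least)
  case base
  then show ?case by simp
next
  case (Suc k)
  have k: "real k > 0" using Suc.hyps by simp
  have "ln (real k) \<le> ln (real (Suc k)) + real k / real (Suc k) - 1"
    by (rule ln_le_tangent) (use k in auto)
  then have "real (Suc k) * ln (real k) \<le> real (Suc k) * (ln (real (Suc k)) + real k / real (Suc k) - 1)"
    by (rule mult_left_mono) simp
  also have "\<dots> = real (Suc k) * ln (real (Suc k)) - 1"
    by (simp add: field_simps)
  finally have step: "real (Suc k) * ln (real k) \<le> real (Suc k) * ln (real (Suc k)) - 1" .
  have "ln (fact (Suc k) :: real) = ln (real (Suc k)) + ln (fact k)"
    by (simp add: ln_mult)
  also have "\<dots> \<le> ln (real (Suc k)) + (real (Suc k) * ln (real k) - real k + 1)"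
    using Suc.IH by simp
  also have "\<dots> \<le> ln (real (Suc k)) + (real (Suc k) * ln (real (Suc k)) - 1 - real k + 1)"
    using step by simp
  also have "\<dots> = real (Suc k + 1) * ln (real (Suc k)) - real (Suc k) + 1"
    by (simp add: algebra_simps)
  finally show ?case .
qed

lemma ln_fact_ge: "real b * ln (real b) - real b \<le> ln (fact b :: real)"
proof (induction b)
  case 0
  then show ?case by simp
next
  case (Suc b)
  show ?case
  proof (cases "b = 0")
    case True
    then show ?thesis by simp
  next
    case False
    have "ln (real (Suc b)) \<le> ln (real b) + real (Suc b) / real b - 1"
      by (rule ln_le_tangent) (use False in auto)
    then have "real b * ln (real (Suc b)) \<le> real b * (ln (real b) + real (Suc b) / real b - 1)"
      by (rule mult_left_mono) simp
    also have "\<dots> = real b * ln (real b) + 1"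
      using False by (simp add: field_simps)
    finally have "real b * ln (real (Suc b)) \<le> real b * ln (real b) + 1" .
    moreover have "ln (fact (Suc b) :: real) = ln (real (Suc b)) + ln (fact b)"
      by (simp add: ln_mult)
    ultimately show ?thesis using Suc by (simp add: algebra_simps)
  qed
qed

text \<open>The growth rate, per unit of the exponent, of the common denominator after the powers of \<open>H\<close> have
been split off.\<close>

definition growth_exponent :: "nat \<Rightarrow> real" where
  "growth_exponent k = real (k + 1) * ln (real (k + 1)) + real k * ln (fact k / 4)"

text \<open>With \<open>W = ln (ln H)\<close>, an exponent \<open>b \<ge> ln H / W\<close> satisfies \<open>ln b \<ge> W - ln W\<close>; the subtracted constant
is that of the condition \<open>b (ln b - 1 - ln (k! / 8)) \<le> ln H + \<dots>\<close> which the last unsuitable exponent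
satisfies for all \<open>n \<ge> 2\<close>. Thus \<open>b\<close> is at most about \<open>ln H / log_slack k W\<close>.\<close>

definition log_slack :: "nat \<Rightarrow> real \<Rightarrow> real" where
  "log_slack k W = W - ln W - (1 + ln (fact k / 8))"

text \<open>The coefficient for which \<open>omega k H = k + omega_factor k / ln (ln H)\<close>.\<close>

definition omega_factor :: "nat \<Rightarrow> real" where
  "omega_factor k = (real k)\<^sup>2 * ln (real k) * (if k \<ge> 5 then 1 + 0.69 / (ln (real k) - 1) else d_const k)"

text \<open>The logarithm is bounded above by its tangent at 8, close to the smallest admissible \<open>W\<close>; the same
is done at 16 for \<open>k = 3\<close> and \<open>k = 4\<close>. The summand 1 added to the growth exponent is room for the
lower-order terms.\<close>

lemma omega_factor_bound_2:
  assumes "s_param 2 2 \<le> W"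
  shows "(growth_exponent 2 + 1) * W \<le> omega_factor 2 * log_slack 2 W" "W / 3 \<le> log_slack 2 W"
proof -
  have l4: "ln (4::real) = 2 * ln 2" using ln_realpow[of 2 2] by simp
  have l8: "ln (8::real) = 3 * ln 2" using ln_realpow[of 2 3] by simp
  have "(1.386::real)\<^sup>2 \<le> (ln 4)\<^sup>2" unfolding l4 using ln2_bounds by (intro power_mono) auto
  then have W: "7.68 \<le> W" using assms unfolding s_param_def by (simp add: power2_eq_square)
  have "ln W \<le> ln 8 + W / 8 - 1" by (rule ln_le_tangent) (use W in auto)
  moreover have "ln (fact 2 / 8 :: real) = - 2 * ln 2"
    using l4 by (simp add: fact_numeral ln_div)
  ultimately have Z: "0.875 * W - 0.7 \<le> log_slack 2 W"
    unfolding log_slack_def using l8 ln2_bounds by simp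
  have E: "growth_exponent 2 \<le> 1.9111"
    unfolding growth_exponent_def using ln2_bounds ln3_bounds by (simp add: fact_numeral ln_div)
  have B: "9.2 \<le> omega_factor 2"
    unfolding omega_factor_def d_const_def using ln2_bounds by simp
  have "(growth_exponent 2 + 1) * W \<le> 2.9111 * W"
    using E W by (intro mult_right_mono) auto
  also have "\<dots> \<le> 9.2 * (0.875 * W - 0.7)" using W by (simp add: algebra_simps)
  also have "\<dots> \<le> omega_factor 2 * log_slack 2 W"
    using B Z W by (intro mult_mono) auto
  finally show "(growth_exponent 2 + 1) * W \<le> omega_factor 2 * log_slack 2 W" .
  show "W / 3 \<le> log_slack 2 W" using Z W by simp
qed

lemma omega_factor_bound_3:
  assumes "s_param 2 3 \<le> W"
  shows "(growth_exponent 3 + 1) * W \<le> omega_factor 3 * log_slack 3 W" "W / 3 \<le> log_slack 3 W"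
proof -
  have l4: "ln (4::real) = 2 * ln 2" using ln_realpow[of 2 2] by simp
  have l16: "ln (16::real) = 4 * ln 2" using ln_realpow[of 2 4] by simp
  have "(1.609::real)\<^sup>2 \<le> (ln 5)\<^sup>2" using ln5_bounds by (intro power_mono) auto
  then have W: "12.94 \<le> W" using assms unfolding s_param_def by (simp add: power2_eq_square)
  have "ln W \<le> ln 16 + W / 16 - 1" by (rule ln_le_tangent) (use W in auto)
  moreover have "ln (fact 3 / 8 :: real) = ln 3 - 2 * ln 2"
    using l4 by (simp add: fact_numeral ln_div)
  ultimately have Z: "0.9375 * W - 2.486 \<le> log_slack 3 W"
    unfolding log_slack_def using l16 ln2_bounds ln3_bounds by simp
  have "ln (fact 3 / 4 :: real) = ln 3 - ln 2"
    by (simp add: fact_numeral ln_div)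
  then have E: "growth_exponent 3 \<le> 6.763"
    unfolding growth_exponent_def using ln2_bounds ln3_bounds l4 by simp
  have B: "11.32 \<le> omega_factor 3"
    unfolding omega_factor_def d_const_def using ln3_bounds by simp
  have "(growth_exponent 3 + 1) * W \<le> 7.763 * W"
    using E W by (intro mult_right_mono) auto
  also have "\<dots> \<le> 11.32 * (0.9375 * W - 2.486)" using W by (simp add: algebra_simps)
  also have "\<dots> \<le> omega_factor 3 * log_slack 3 W"
    using B Z W by (intro mult_mono) auto
  finally show "(growth_exponent 3 + 1) * W \<le> omega_factor 3 * log_slack 3 W" .
  show "W / 3 \<le> log_slack 3 W" using Z W by simp
qed

lemma omega_factor_bound_4:
  assumes "s_param 2 4 \<le> W"
  shows "(growth_exponent 4 + 1) * W \<le> omega_factor 4 * log_slack 4 W" "W / 3 \<le> log_slack 4 W"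
proof -
  have l4: "ln (4::real) = 2 * ln 2" using ln_realpow[of 2 2] by simp
  have l16: "ln (16::real) = 4 * ln 2" using ln_realpow[of 2 4] by simp
  have l6: "ln (6::real) = ln 2 + ln 3" using ln_mult[of 2 "3::real"] by simp
  have "(1.7916::real)\<^sup>2 \<le> (ln 6)\<^sup>2" unfolding l6 using ln2_bounds ln3_bounds by (intro power_mono) auto
  then have W: "19.25 \<le> W" using assms unfolding s_param_def by (simp add: power2_eq_square)
  have "ln W \<le> ln 16 + W / 16 - 1" by (rule ln_le_tangent) (use W in auto)
  moreover have "fact 4 / 8 = (3 :: real)" by (simp add: fact_numeral)
  ultimately have Z: "0.9375 * W - 3.872 \<le> log_slack 4 W"
    unfolding log_slack_def using l16 ln2_bounds ln3_bounds by simp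
  have "fact 4 / 4 = (6 :: real)" by (simp add: fact_numeral)
  then have E: "growth_exponent 4 \<le> 15.216"
    unfolding growth_exponent_def using ln2_bounds ln3_bounds ln5_bounds l6 by simp
  have B: "24.7 \<le> omega_factor 4"
    unfolding omega_factor_def d_const_def using ln2_bounds l4 by simp
  have "(growth_exponent 4 + 1) * W \<le> 16.216 * W"
    using E W by (intro mult_right_mono) auto
  also have "\<dots> \<le> 24.7 * (0.9375 * W - 3.872)" using W by (simp add: algebra_simps)
  also have "\<dots> \<le> omega_factor 4 * log_slack 4 W"
    using B Z W by (intro mult_mono) auto
  finally show "(growth_exponent 4 + 1) * W \<le> omega_factor 4 * log_slack 4 W" .
  show "W / 3 \<le> log_slack 4 W" using Z W by simp
qed

text \<open>The case \<open>k \<ge> 5\<close> of the comparison, with \<open>x = k\<close>, \<open>y = ln k\<close> and denominators cleared. As a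
polynomial in \<open>x\<close> the difference of the two sides has leading coefficient
\<open>0.69 y^2 + 0.31 y - 0.31\<close>, which is where the constant 0.69 enters; the coefficient of \<open>x^2\<close> is only
of order \<open>- 2 y^3\<close> and is controlled by the bound \<open>5 y - 3.05 \<le> x\<close>, a tangent estimate for the
logarithm.\<close>

lemma polynomial_inequality:
  fixes x y :: real
  assumes "5 \<le> x" "1.609 \<le> y" "5 * y - 3.05 \<le> x"
  shows "(x\<^sup>2 * y - x\<^sup>2 + (2 * x + 1) * y - 0.386 * x + 2.2) * (x + 2) * (y\<^sup>2 - y)
    \<le> x\<^sup>2 * (y - 0.31) * ((x + 2) * y\<^sup>2 - (x + 3) * y + x)"
proof -
  define P where "P = 0.69 * y\<^sup>2 + 0.31 * y - 0.31"
  define R where "R = (y\<^sup>2 - y) * (5 * y + 1.428)"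
  define S where "S = (y\<^sup>2 - y) * (2 * y + 4.4)"
  have y2: "1.609 * y \<le> y\<^sup>2" using assms by (simp add: power2_eq_square)
  have y3: "1.609 * y\<^sup>2 \<le> y ^ 3" using assms by (simp add: power2_eq_square power3_eq_cube mult_right_mono)
  have P0: "0 \<le> P" unfolding P_def using y2 assms by simp
  have R0: "0 \<le> R" unfolding R_def using y2 assms by (intro mult_nonneg_nonneg) auto
  have S0: "0 \<le> S" unfolding S_def using y2 assms by (intro mult_nonneg_nonneg) auto
  have "(5 * y - 3.05) * P \<le> x * P" using assms P0 by (intro mult_right_mono) auto
  \<comment> \<open>The lower bound \<open>5 y - 3.05\<close> for \<open>x\<close> makes the expression a cubic in \<open>y\<close> alone, positive for \<open>y \<ge> 1.609\<close>.\<close>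
  moreover have "(5 * y - 3.05) * P - 2 * y ^ 3 + 2.766 * y\<^sup>2 - 1.456 * y - R / 5 - S / 25
      = 0.37 * y ^ 3 + 2.8299 * y\<^sup>2 - 3.4899 * y + 0.9455"
    unfolding P_def R_def S_def by (simp add: field_simps power2_eq_square power3_eq_cube)
  moreover have "0 \<le> 0.37 * y ^ 3 + 2.8299 * y\<^sup>2 - 3.4899 * y + 0.9455"
    using y2 y3 assms by simp
  ultimately have "0 \<le> x * P - 2 * y ^ 3 + 2.766 * y\<^sup>2 - 1.456 * y - R / 5 - S / 25" by linarith
  then have "0 \<le> x\<^sup>2 * (x * P - 2 * y ^ 3 + 2.766 * y\<^sup>2 - 1.456 * y - R / 5 - S / 25)"
    by (intro mult_nonneg_nonneg) auto
  moreover have "x * R \<le> x\<^sup>2 * R / 5"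
    using mult_right_mono[OF assms(1), of "x * R"] assms(1) R0 by (simp add: power2_eq_square algebra_simps)
  moreover have "S \<le> x\<^sup>2 * S / 25"
  proof -
    have "25 * S \<le> x\<^sup>2 * S" using assms(1) S0 power_mono[OF assms(1), of 2] by (intro mult_right_mono) auto
    then show ?thesis by simp
  qed
  ultimately have "0 \<le> x\<^sup>2 * (x * P - 2 * y ^ 3 + 2.766 * y\<^sup>2 - 1.456 * y) - x * R - S"
    by (simp add: algebra_simps)
  also have "\<dots> = x\<^sup>2 * (y - 0.31) * ((x + 2) * y\<^sup>2 - (x + 3) * y + x)
      - (x\<^sup>2 * y - x\<^sup>2 + (2 * x + 1) * y - 0.386 * x + 2.2) * (x + 2) * (y\<^sup>2 - y)"
    unfolding P_def R_def S_def by (simp add: power2_eq_square power3_eq_cube) (simp add: field_simps)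
  finally show ?thesis by simp
qed

text \<open>Everything is expressed through \<open>x = k\<close> and \<open>y = ln k\<close>, using the tangent of the logarithm at
\<open>w = (k + 2) (ln k)^2\<close>, a lower bound for \<open>W\<close>. This gives \<open>log_slack k W \<ge> W (1 - N / w)\<close>, where
\<open>N\<close> bounds \<open>ln w + 1 + ln (k! / 8)\<close>, and reduces the claim to the polynomial inequality.\<close>

lemma omega_factor_bound_large:
  assumes "5 \<le> k" "s_param 2 k \<le> W"
  shows "(growth_exponent k + 1) * W \<le> omega_factor k * log_slack k W" "W / 3 \<le> log_slack k W"
proof -
  define x where "x = real k"
  define y where "y = ln x"
  have x: "5 \<le> x" using assms by (simp add: x_def)
  have "ln 5 \<le> ln x" using x by simp
  then have y: "1.609 \<le> y" using ln5_bounds by (simp add: y_def)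
  have yx: "5 * y - 3.05 \<le> x"
    using ln_le_tangent[of 5 x] x ln5_bounds unfolding y_def by simp
  have inv: "2 / x \<le> 0.4" "1 / x \<le> 0.2" using x by (auto simp: field_simps)
  have l4: "ln (4::real) = 2 * ln 2" using ln_realpow[of 2 2] by simp
  have l8: "ln (8::real) = 3 * ln 2" using ln_realpow[of 2 3] by simp
  have fact: "ln (fact k :: real) \<le> (x + 1) * y - x + 1"
    using ln_fact_le[of k] assms by (simp add: x_def y_def add.commute)
  have k1: "ln (x + 1) \<le> y + 1 / x" and k2: "ln (x + 2) \<le> y + 2 / x"
    using ln_le_tangent[of x "x + 1"] ln_le_tangent[of x "x + 2"] x by (simp_all add: y_def field_simps)
  define e where "e = x\<^sup>2 * y - x\<^sup>2 + (2 * x + 1) * y - 0.386 * x + 2.2"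
  have E: "growth_exponent k + 1 \<le> e"
  proof -
    have "(x + 1) * ln (x + 1) \<le> (x + 1) * (y + 1 / x)" using k1 x by (intro mult_left_mono) auto
    also have "\<dots> = (x + 1) * y + 1 + 1 / x" using x by (simp add: field_simps)
    finally have 1: "(x + 1) * ln (x + 1) \<le> (x + 1) * y + 1.2" using inv by simp
    have "ln (fact k / 4 :: real) \<le> (x + 1) * y - x - 0.386"
      using fact l4 ln2_bounds by (simp add: ln_div)
    then have "x * ln (fact k / 4 :: real) \<le> x * ((x + 1) * y - x - 0.386)"
      using x by (intro mult_left_mono) auto
    with 1 show ?thesis
      unfolding growth_exponent_def e_def by (simp add: x_def[symmetric] algebra_simps power2_eq_square)
  qed
  define N where "N = (x + 3) * y - x"
  define w where "w = (x + 2) * y\<^sup>2"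
  have w0: "0 < w" using x y by (simp add: w_def)
  have wW: "w \<le> W"
  proof -
    have "y \<le> ln (x + 2)" using x by (simp add: y_def)
    then have "w \<le> s_param 2 k" unfolding w_def s_param_def using x y
      by (auto simp: x_def[symmetric] add_ac intro!: mult_mono power_mono)
    with assms(2) show ?thesis by simp
  qed
  have N1: "1 \<le> N"
  proof -
    have "(x + 3) * 1.609 \<le> (x + 3) * y" using x y by (intro mult_left_mono) auto
    then show ?thesis unfolding N_def using x by simp
  qed
  have "ln w \<le> 2 * y + 2 / x - 0.6136"
  proof -
    have "ln w = ln (x + 2) + 2 * ln y" using x y by (simp add: w_def ln_mult ln_realpow)
    moreover have "ln y \<le> ln 2 + y / 2 - 1" by (rule ln_le_tangent) (use y in auto)
    ultimately show ?thesis using k2 ln2_bounds by simp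
  qed
  moreover have "1 + ln (fact k / 8 :: real) \<le> (x + 1) * y - x + 2 - 2.079"
    using fact l8 ln2_bounds by (simp add: ln_div)
  ultimately have "ln w + (1 + ln (fact k / 8 :: real)) \<le> N"
    unfolding N_def using inv by (simp add: algebra_simps)
  moreover have "ln W \<le> ln w + W / w - 1" by (rule ln_le_tangent) (use w0 wW in auto)
  ultimately have "W - (W / w + (N - 1)) \<le> log_slack k W" unfolding log_slack_def by simp
  moreover have "(N - 1) * 1 \<le> (N - 1) * (W / w)"
    using N1 w0 wW by (intro mult_left_mono) auto
  ultimately have Z: "W * (1 - N / w) \<le> log_slack k W" by (simp add: algebra_simps diff_divide_distrib)
  have Qw: "1 - N / w = (w - N) / w" using w0 by (simp add: field_simps)
  have Q: "w - N = (x + 2) * y\<^sup>2 - (x + 3) * y + x" by (simp add: w_def N_def)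
  have W0: "0 < W" using w0 wW by simp
  have third: "1 / 3 \<le> 1 - N / w"
  proof -
    have "0 \<le> 14 * (y - 12 / 14)\<^sup>2 + 15 - 144 / 14" by simp
    also have "\<dots> = 5 * (2 * y\<^sup>2 - 3 * y + 3) + 4 * y\<^sup>2 - 9 * y"
      by (simp add: power2_eq_square field_simps)
    also have "5 * (2 * y\<^sup>2 - 3 * y + 3) \<le> x * (2 * y\<^sup>2 - 3 * y + 3)"
    proof (rule mult_right_mono[OF x])
      have "0 \<le> 2 * (y - 3 / 4)\<^sup>2 + 3 - 9 / 8" by simp
      then show "0 \<le> 2 * y\<^sup>2 - 3 * y + 3" by (simp add: power2_eq_square algebra_simps)
    qed
    finally have "w \<le> 3 * (w - N)" by (simp add: w_def N_def algebra_simps)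
    then show ?thesis unfolding Qw using w0 by (simp add: field_simps)
  qed
  have "W * (1 / 3) \<le> W * (1 - N / w)" using third W0 by (intro mult_left_mono) auto
  with Z show "W / 3 \<le> log_slack k W" by linarith
  have B: "omega_factor k = x\<^sup>2 * y * (y - 0.31) / (y - 1)"
    using assms y unfolding omega_factor_def by (simp add: x_def[symmetric] y_def[symmetric] field_simps)
  have B0: "0 \<le> omega_factor k" unfolding B using x y by (intro divide_nonneg_nonneg mult_nonneg_nonneg) auto
  have "e \<le> omega_factor k * (1 - N / w)"
  proof -
    have "e * ((x + 2) * (y\<^sup>2 - y)) \<le> x\<^sup>2 * (y - 0.31) * (w - N)"
      using polynomial_inequality[OF x y yx] unfolding e_def Q by (simp only: mult.assoc)
    moreover have yy: "y\<^sup>2 - y = y * (y - 1)" by (simp add: power2_eq_square algebra_simps)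
    have d: "0 < (x + 2) * (y\<^sup>2 - y)" unfolding yy using x y by (intro mult_pos_pos) auto
    ultimately have "e \<le> x\<^sup>2 * (y - 0.31) * (w - N) / ((x + 2) * (y\<^sup>2 - y))"
      by (simp only: pos_le_divide_eq)
    also have "\<dots> = omega_factor k * (1 - N / w)"
    proof -
      have "x\<^sup>2 * (y - 0.31) * d / ((x + 2) * (y * (y - 1)))
          = x\<^sup>2 * y * (y - 0.31) / (y - 1) * (d / ((x + 2) * y\<^sup>2))" for d
        using x y by (simp add: divide_simps power2_eq_square)
      then show ?thesis unfolding B Qw yy by (simp only: w_def)
    qed
    finally show ?thesis .
  qed
  then have "(growth_exponent k + 1) * W \<le> omega_factor k * (1 - N / w) * W"
    using E W0 by (intro mult_right_mono) auto
  also have "\<dots> = omega_factor k * (W * (1 - N / w))" by simp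
  also have "\<dots> \<le> omega_factor k * log_slack k W" using Z B0 by (rule mult_left_mono)
  finally show "(growth_exponent k + 1) * W \<le> omega_factor k * log_slack k W" .
qed

text \<open>Since \<open>b\<close> is about \<open>ln H / log_slack k W\<close>, the first inequality says that \<open>exp (b E)\<close>, with some room
to spare, is below \<open>H\<close> to the power \<open>omega_factor k / W\<close>.\<close>

lemma omega_factor_bound:
  assumes "2 \<le> k" "s_param 2 k \<le> W"
  shows "(growth_exponent k + 1) * W \<le> omega_factor k * log_slack k W" "W / 3 \<le> log_slack k W"
proof -
  consider "k = 2" | "k = 3" | "k = 4" | "5 \<le> k" using assms(1) by linarith
  then have "(growth_exponent k + 1) * W \<le> omega_factor k * log_slack k W \<and> W / 3 \<le> log_slack k W"
    using omega_factor_bound_2 omega_factor_bound_3 omega_factor_bound_4 omega_factor_bound_large assms(2)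
    by cases auto
  then show "(growth_exponent k + 1) * W \<le> omega_factor k * log_slack k W" "W / 3 \<le> log_slack k W" by auto
qed

section \<open>Choice of the exponent and the final estimate\<close>

text \<open>Multiply the linear form by the common denominator \<open>approximant n k a u 0\<close>. The result is a nonzero
integer up to an error of at most \<open>1/2\<close>; only the terms with \<open>i \<ge> 1\<close> contribute to the error,
since \<open>exp 0\<close> is represented exactly. The power \<open>k^(2 k + 2)\<close> is a crude bound for the constants in the error.\<close>

lemma linear_form_lower_bound:
  fixes l :: "nat \<Rightarrow> int" and H :: real
  assumes "2 \<le> n" "n \<le> k" "fact k + 1 dvd a + 1"
    and small: "H * real k ^ (2 * k + 2) * (fact k / 4) ^ a \<le> real n ^ a * fact a"
    and H: "0 \<le> H" "\<And>i. 1 \<le> i \<Longrightarrow> i \<le> k \<Longrightarrow> \<bar>real_of_int (l i)\<bar> \<le> H"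
    and "i0 \<le> k" "l i0 \<noteq> 0"
  shows "1 \<le> 2 * (real n ^ (k * a + k) * real (k + 1) ^ ((k + 1) * a) * fact a ^ k
              * real ((k + 1) * a + 2 * k) ^ (2 * k))
            * \<bar>\<Sum>i\<le>k. real_of_int (l i) * exp (real i / real n)\<bar>"
proof -
  define U where "U = real n ^ (k * a + k) * real (k + 1) ^ ((k + 1) * a) * fact a ^ k
              * real ((k + 1) * a + 2 * k) ^ (2 * k)"
  define D where "D = real n ^ a * fact a"
  define R where "R = real k / 2 * exp (real k / 2) * real k ^ k * (fact k / 4) ^ a / D"
  define \<Lambda> where "\<Lambda> = (\<Sum>i\<le>k. real_of_int (l i) * exp (real i / real n))"
  have k: "2 \<le> k" and n: "0 < n" using assms by auto
  have D: "0 < D" using n by (simp add: D_def)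
  obtain u where u: "u \<le> k" and nz: "(\<Sum>j\<le>k. l j * approximant n k a u j) \<noteq> 0"
    using approximant_nonvanishing[where l = l and ?i0.0 = i0] assms n by metis
  let ?A = "\<lambda>j. real_of_int (approximant n k a u j)"
  let ?r = "\<lambda>j. exp (real j / real n) * ?A 0 - ?A j"
  have "1 \<le> \<bar>\<Sum>j\<le>k. l j * approximant n k a u j\<bar>" using nz by linarith
  then have "1 \<le> real_of_int \<bar>\<Sum>j\<le>k. l j * approximant n k a u j\<bar>" by (simp only: of_int_1_le_iff)
  then have main: "1 \<le> \<bar>\<Sum>j\<le>k. real_of_int (l j) * ?A j\<bar>" by simp
  have err: "\<bar>\<Sum>j\<le>k. real_of_int (l j) * ?r j\<bar> \<le> real k * (H * R)"
  proof -
    have "(\<Sum>j\<le>k. real_of_int (l j) * ?r j) = (\<Sum>j=1..k. real_of_int (l j) * ?r j)"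
      by (rule sum.mono_neutral_right) (auto simp: Suc_le_eq)
    also have "\<bar>\<dots>\<bar> \<le> (\<Sum>j=1..k. H * R)"
    proof (rule order_trans[OF sum_abs], rule sum_mono)
      fix j assume j: "j \<in> {1..k}"
      have "\<bar>?r j\<bar> \<le> R"
        using approximant_remainder[OF assms(1) u, of j a] j unfolding R_def D_def by auto
      moreover have "0 \<le> H" by (rule H(1))
      ultimately show "\<bar>real_of_int (l j) * ?r j\<bar> \<le> H * R"
        unfolding abs_mult using H(2)[of j] j by (intro mult_mono) auto
    qed
    finally show ?thesis by simp
  qed
  have half: "real k * (H * R) \<le> 1 / 2"
  proof -
    \<comment> \<open>The exponential factor is absorbed by \<open>exp (k / 2) \<le> 2^k \<le> k^k\<close>.\<close>
    have "exp (1 / 2 :: real) \<le> 2"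
    proof (rule power2_le_imp_le)
      show "(exp (1 / 2 :: real))\<^sup>2 \<le> 2\<^sup>2"
        using exp_le by (simp add: exp_double[symmetric])
    qed simp
    then have "exp (1 / 2 :: real) ^ k \<le> real k ^ k"
      using k by (intro power_mono) auto
    then have ek: "exp (real k / 2) \<le> real k ^ k"
      using exp_of_nat_mult[of k "1 / 2 :: real"] by simp
    have "real k * (H * R) = H * (real k ^ (k + 2) * exp (real k / 2)) * (fact k / 4) ^ a / (2 * D)"
      unfolding R_def by (simp add: power_add power2_eq_square mult_ac)
    also have "\<dots> \<le> H * (real k ^ (k + 2) * real k ^ k) * (fact k / 4) ^ a / (2 * D)"
      using ek H(1) D by (intro divide_right_mono mult_right_mono mult_left_mono) auto
    also have "real k ^ (k + 2) * real k ^ k = real k ^ (2 * k + 2)"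
      by (simp flip: power_add add: mult_2)
    also have "H * real k ^ (2 * k + 2) * (fact k / 4) ^ a / (2 * D) \<le> D / (2 * D)"
      using small D unfolding D_def[symmetric] by (intro divide_right_mono) auto
    finally show ?thesis using D by simp
  qed
  have "?A 0 * \<Lambda> = (\<Sum>j\<le>k. real_of_int (l j) * ?A j) + (\<Sum>j\<le>k. real_of_int (l j) * ?r j)"
    unfolding \<Lambda>_def sum_distrib_left sum.distrib[symmetric] by (intro sum.cong) (simp_all add: algebra_simps)
  then have "1 / 2 \<le> \<bar>?A 0 * \<Lambda>\<bar>" using main err half by linarith
  also have "\<dots> \<le> U * \<bar>\<Lambda>\<bar>"
    unfolding abs_mult U_def using approximant_0_le[OF u n] by (intro mult_right_mono) auto
  finally show ?thesis unfolding U_def \<Lambda>_def by simp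
qed

text \<open>Take for \<open>b\<close> the greatest exponent that is still too small; it exists because factorials outgrow
powers. Every later exponent is suitable, in particular the first one with \<open>q dvd a + 1\<close>.\<close>

lemma exponent_choice:
  fixes C M :: real
  assumes "n > 0" "C > 1" "q > 0"
  obtains a b :: nat where "b < a" "a \<le> b + q" "q dvd a + 1"
    "real n ^ b * fact b < C * M ^ b" "C * M ^ a \<le> real n ^ a * fact a"
proof -
  let ?bad = "\<lambda>b. real n ^ b * fact b < C * M ^ b"
  have "(\<lambda>b. inverse (fact b) * M ^ b) \<longlonglongrightarrow> 0"
    by (rule summable_LIMSEQ_zero[OF summable_exp])
  then have "eventually (\<lambda>b. inverse (fact b) * M ^ b < 1 / C) sequentially"
    using assms(2) by (intro order_tendstoD(2)[of _ 0]) auto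
  then obtain N where N: "\<And>b. N \<le> b \<Longrightarrow> inverse (fact b) * M ^ b < 1 / C"
    unfolding eventually_sequentially by blast
  have good: "\<not> ?bad b" if "N \<le> b" for b
  proof -
    have "C * M ^ b \<le> fact b" using N[OF that] assms(2) by (simp add: field_simps)
    also have "\<dots> \<le> real n ^ b * fact b"
      using assms(1) by (simp add: one_le_power Suc_leI)
    finally show ?thesis by simp
  qed
  define b where "b = (GREATEST b. ?bad b)"
  have bound: "\<forall>b. ?bad b \<longrightarrow> b \<le> N" using good by (meson nat_le_linear)
  have "?bad 0" using assms(2) by simp
  then have bad: "?bad b" unfolding b_def by (rule GreatestI_nat) (use bound in blast)
  have great: "b' \<le> b" if "?bad b'" for b'
    unfolding b_def by (rule Greatest_le_nat) (use bound that in blast)+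
  \<comment> \<open>The least \<open>a > b\<close> with \<open>q dvd a + 1\<close>.\<close>
  define a where "a = q * ((b + 1) div q + 1) - 1"
  have a1: "a + 1 = q * ((b + 1) div q + 1)" using assms(3) by (simp add: a_def)
  have "b + 1 = q * ((b + 1) div q) + (b + 1) mod q" "(b + 1) mod q < q" using assms(3) by simp_all
  then have "b + 1 < a + 1" "a + 1 \<le> b + 1 + q" unfolding a1 distrib_left by linarith+
  then have "b < a" "a \<le> b + q" by auto
  moreover have "q dvd a + 1" unfolding a1 by simp
  moreover have "C * M ^ a \<le> real n ^ a * fact a" using great[of a] \<open>b < a\<close> by force
  ultimately show thesis using bad that by blast
qed

text \<open>This is how a lower bound on \<open>H\<close> of the size assumed in the theorem absorbs all lower-order terms:
with \<open>W = ln (ln H)\<close> the right-hand side is \<open>ln H\<close>. After taking logarithms, the tangent of \<open>ln W\<close> at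
\<open>s = s_param 2 k\<close> reduces the claim to \<open>W = s\<close>, where it is tightest for \<open>k = 2\<close>; there the bound
\<open>(k + 1)! \<le> 6 (k + 2)^(k - 2)\<close> is an equality.\<close>

lemma quadratic_le_exp:
  assumes "2 \<le> k" "s_param 2 k \<le> W"
  shows "4 * real k * (fact k + 1) * W\<^sup>2 \<le> exp W"
proof -
  define L where "L = ln (real (k + 2))"
  define s where "s = s_param 2 k"
  have l4: "ln (4::real) = 2 * ln 2" using ln_realpow[of 2 2] by simp
  have l24: "ln (24::real) \<le> 3.1783"
    using ln_realpow[of 2 3] ln_mult[of 8 "3::real"] ln2_bounds ln3_bounds by simp
  have "ln 4 \<le> L" unfolding L_def using assms by simp
  then have L: "1.386 \<le> L" using l4 ln2_bounds by simp
  have s: "s = real (k + 2) * L\<^sup>2" by (simp add: s_def s_param_def L_def)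
  have L2: "1.386 * L \<le> L\<^sup>2" using L by (simp add: power2_eq_square)
  have "4 * (1.386 * 1.386) \<le> real (k + 2) * L\<^sup>2"
    using assms L L2 by (intro mult_mono) auto
  then have s7: "7 \<le> s" by (simp add: s)
  have W: "0 < W" using s7 assms by (simp add: s_def)
  have fact_le: "ln (fact (k + 1) :: real) \<le> ln 6 + (real k - 2) * L"
    using assms(1) unfolding L_def
  proof (induction k rule: nat_induct_at_least)
    case base
    then show ?case by (simp add: fact_numeral eval_nat_numeral)
  next
    case (Suc k)
    have "ln (fact (Suc k + 1) :: real) = ln (real (k + 2)) + ln (fact (k + 1))"
      by (simp add: ln_mult)
    also have "\<dots> \<le> ln (real (Suc k + 2)) + (ln 6 + (real k - 2) * ln (real (Suc k + 2)))"
    proof -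
      have "ln (real (k + 2)) \<le> ln (real (Suc k + 2))" by simp
      moreover from this have "(real k - 2) * ln (real (k + 2)) \<le> (real k - 2) * ln (real (Suc k + 2))"
        using Suc.hyps by (intro mult_left_mono) auto
      ultimately show ?thesis using Suc.IH by linarith
    qed
    finally show ?case by (simp add: algebra_simps)
  qed
  have "real k \<le> fact k" by (metis fact_ge_self of_nat_fact of_nat_le_iff)
  then have kq: "real k * (fact k + 1) \<le> fact (k + 1)" by (simp add: algebra_simps)
  have lnL: "ln L \<le> L - 1" using L by (intro ln_le_minus_one) simp
  have "ln (4 * real k * (fact k + 1)) \<le> ln (4 * fact (k + 1))"
    using kq assms by (subst ln_le_cancel_iff) (auto simp: add_pos_pos)
  also have "\<dots> = ln 4 + ln (fact (k + 1))" by (simp add: ln_mult del: fact_Suc)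
  also have "\<dots> \<le> ln 24 + (real k - 2) * L"
    using fact_le ln_mult[of 4 "6::real"] by simp
  finally have A: "ln (4 * real k * (fact k + 1)) \<le> 3.1783 + (real k - 2) * L" using l24 by simp
  have "ln s = ln (real (k + 2)) + 2 * ln L" unfolding s using L by (simp add: ln_mult ln_realpow)
  then have B: "ln s \<le> 3 * L - 2" using lnL by (simp add: L_def)
  have small: "3.1783 + (real k - 2) * L + 2 * (3 * L - 2) \<le> s"
  proof -
    consider "k = 2" | "k = 3" | "4 \<le> k" using assms(1) by linarith
    then show ?thesis
    proof cases
      case 1
      then have "L \<le> 1.4" using l4 ln2_bounds by (simp add: L_def)
      then show ?thesis using 1 L2 by (simp add: s)
    next
      case 2
      then have "1.6 \<le> L" using ln5_bounds by (simp add: L_def)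
      then have "1.6 * L \<le> L\<^sup>2" by (simp add: power2_eq_square)
      then show ?thesis using 2 L by (simp add: s)
    next
      case 3
      have "(real k + 4) * L \<le> ((real k + 2) * 1.386) * L"
        using 3 L by (intro mult_right_mono) auto
      also have "\<dots> = (real k + 2) * (1.386 * L)" by simp
      also have "\<dots> \<le> (real k + 2) * L\<^sup>2" by (intro mult_left_mono L2) simp
      also have "\<dots> = s" by (simp add: s)
      finally show ?thesis by (simp add: algebra_simps)
    qed
  qed
  define r where "r = W / s"
  have "ln W \<le> ln s + r - 1" unfolding r_def by (rule ln_le_tangent) (use s7 W in auto)
  moreover have "s - 2 \<le> W - 2 * r"
  proof -
    have "s * (1 - 2 / s) \<le> W * (1 - 2 / s)"
      using s7 assms by (intro mult_right_mono) (auto simp: s_def)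
    then show ?thesis unfolding r_def using s7 by (simp add: algebra_simps)
  qed
  moreover have "3.1783 + (real k - 2) * L \<le> s - 2 * (3 * L - 2)" using small by simp
  then have "ln (4 * real k * (fact k + 1)) \<le> s - 2 * (3 * L - 2)" using A by (rule order_trans[rotated])
  ultimately have "ln (4 * real k * (fact k + 1)) + 2 * ln W \<le> W" using B by argo
  moreover have pos: "0 < 4 * real k * (fact k + 1)"
    using assms(1) by (intro mult_pos_pos add_pos_pos) auto
  moreover from this have "ln (4 * real k * (fact k + 1) * W\<^sup>2) = ln (4 * real k * (fact k + 1)) + 2 * ln W"
    using W ln_mult_pos[OF pos, of "W\<^sup>2"] ln_realpow[of W 2] by (simp only: zero_less_power of_nat_numeral)
  ultimately have "ln (4 * real k * (fact k + 1) * W\<^sup>2) \<le> W" by simp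
  then have "exp (ln (4 * real k * (fact k + 1) * W\<^sup>2)) \<le> exp W" by simp
  moreover have "0 < 4 * real k * (fact k + 1) * W\<^sup>2" by (rule mult_pos_pos[OF pos]) (use W in simp)
  ultimately show ?thesis by (simp only: exp_ln)
qed

text \<open>Taking logarithms, \<open>(a!)^k n^(k a)\<close> is compared with \<open>(b!)^k n^(k b)\<close> and thereby with \<open>H^k\<close>, as \<open>b\<close> is
unsuitable. What remains is \<open>b E\<close> plus lower-order terms, the latter at most \<open>7/2 v\<close> with
\<open>v = k (k! + 1) W\<close>. Since \<open>b\<close> is at most \<open>(ln H + ln K) / log_slack k W\<close> with \<open>K = k^(2 k + 2)\<close>,
the claim follows from \<open>omega_factor_bound\<close> and the growth inequality \<open>4 v W \<le> ln H\<close>.\<close>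

lemma final_estimate:
  fixes H :: real
  assumes nk: "2 \<le> n" "n \<le> k" and H: "1 < H" and Y: "1 < ln H" and Ws: "s_param 2 k \<le> ln (ln H)"
    and a: "b < a" "a \<le> b + (fact k + 1)"
    and bad: "real n ^ b * fact b < H * real k ^ (2 * k + 2) * (fact k / 4) ^ b"
  shows "2 * (real n ^ (k * a + k) * real (k + 1) ^ ((k + 1) * a) * fact a ^ k
              * real ((k + 1) * a + 2 * k) ^ (2 * k))
          \<le> exp ((real k + omega_factor k / ln (ln H)) * ln H)" (is "2 * ?U \<le> _")
proof -
  define Y where "Y = ln H"
  define W where "W = ln Y"
  define L where "L = ln (real (k + 2))"
  define q where "q = (fact k + 1 :: real)"
  define Z where "Z = log_slack k W"
  define E where "E = growth_exponent k"
  define lK where "lK = real (2 * k + 2) * ln (real k)"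
  define c where "c = 1 + ln (fact k / 8 :: real)"
  have k: "2 \<le> k" using nk by simp
  have W: "s_param 2 k \<le> W" using Ws by (simp add: W_def Y_def)
  have Y0: "0 < Y" using assms(4) by (simp add: Y_def)
  have expW: "exp W = Y" using Y0 by (simp add: W_def)
  \<comment> \<open>The basic size relations; \<open>v = k q W\<close> will be the common scale of all lower-order terms.\<close>
  have f2: "2 \<le> (fact k :: real)"
    using fact_mono[OF k, where ?'a = real] by (simp add: fact_numeral)
  have q3: "3 \<le> q" using f2 by (simp add: q_def)
  have "ln 4 \<le> L" unfolding L_def using k by simp
  then have L: "4 / 3 \<le> L" using ln_realpow[of 2 2] ln2_ge_two_thirds by simp
  have WL: "real (k + 2) * L * (4 / 3) \<le> W"
  proof -
    have "real (k + 2) * L * (4 / 3) \<le> real (k + 2) * L * L" using L by (intro mult_left_mono) auto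
    moreover have "s_param 2 k = real (k + 2) * L * L"
      by (simp add: s_param_def L_def power2_eq_square)
    ultimately show ?thesis using W by linarith
  qed
  have "real (k + 2) * L \<ge> 4 * (4 / 3)" using k L by (intro mult_mono) auto
  then have W7: "7 \<le> W" using WL by linarith
  have LW: "L \<le> 3 / 16 * W"
  proof -
    have "4 * L \<le> real (k + 2) * L" using k L by (intro mult_right_mono) auto
    with WL show ?thesis by linarith
  qed
  have lk: "0 \<le> ln (real k)" "ln (real k) \<le> L" "ln (real n) \<le> L" "ln (real (k + 1)) \<le> L"
    "0 \<le> ln (real n)" "ln 2 \<le> ln (real n)"
    using nk k by (auto simp: L_def)
  have lK0: "0 \<le> lK" using lk by (simp add: lK_def)
  have lKW: "lK \<le> 3 / 2 * W"
  proof -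
    have "lK \<le> real (2 * k + 2) * L" unfolding lK_def using lk by (intro mult_left_mono) auto
    also have "\<dots> \<le> 2 * (real (k + 2) * L)" using L by (simp add: algebra_simps)
    finally show ?thesis using WL by linarith
  qed
  have growth: "4 * real k * q * W\<^sup>2 \<le> Y"
    using quadratic_le_exp[OF k W] expW by (simp add: q_def)
  define v where "v = real k * q * W"
  have kW: "real k * W \<le> v / 3"
  proof -
    have "real k * W * 3 \<le> real k * W * q" using q3 W7 by (intro mult_left_mono) auto
    then show ?thesis by (simp add: v_def mult_ac)
  qed
  have qW: "q * W \<le> v / 2"
  proof -
    have "2 * (q * W) \<le> real k * (q * W)" using q3 W7 k by (intro mult_right_mono) auto
    then show ?thesis by (simp add: v_def mult_ac)
  qed
  have vY: "4 * v * W \<le> Y" using growth by (simp add: v_def power2_eq_square mult_ac)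
  have v0: "0 < v" unfolding v_def using k q3 W7 by auto
  have v7: "28 * v \<le> Y"
  proof -
    have "7 * (4 * v) \<le> W * (4 * v)" using W7 v0 by (intro mult_right_mono) auto
    with vY show ?thesis by (simp add: mult_ac)
  qed
  have "7 * q \<le> q * W" using W7 q3 by simp
  then have qv: "7 * q \<le> v / 2" using qW by (rule order_trans)
  have "2 * W \<le> real k * W" using k W7 by (intro mult_right_mono) auto
  then have Wv: "2 * W \<le> v / 3" using kW by (rule order_trans)
  \<comment> \<open>The crude bound \<open>2 \<le> Z\<close> suffices for the lower-order terms; \<open>main\<close> carries the precise constants.\<close>
  have Z_ge: "W / 3 \<le> Z" and main: "(E + 1) * W \<le> omega_factor k * Z"
    using omega_factor_bound[OF k W] by (simp_all add: Z_def E_def)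
  have Z2: "2 \<le> Z" using Z_ge W7 by simp
  have Zc: "Z = W - ln W - c" by (simp add: Z_def log_slack_def c_def)
  have ZW: "Z \<le> W"
  proof -
    have "ln (1 / 4) \<le> ln (fact k / 8 :: real)" using f2 by (subst ln_le_cancel_iff) auto
    moreover have "ln (4::real) \<le> ln W" using W7 by simp
    ultimately show ?thesis unfolding Zc c_def by (simp add: ln_div)
  qed
  have lM: "ln (fact k / 8 :: real) = ln (fact k / 4) - ln 2"
    using ln_div[of "fact k / 4" "2::real"] by simp
  have E0: "0 \<le> E"
  proof -
    have "ln (1 / 2) \<le> ln (fact k / 4 :: real)" using f2 by (subst ln_le_cancel_iff) auto
    then have "- ln 2 \<le> ln (fact k / 4 :: real)" by (simp add: ln_div)
    then have "real k * (- ln 2) \<le> real k * ln (fact k / 4 :: real)" by (intro mult_left_mono) auto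
    moreover have "real k * ln 2 \<le> real (k + 1) * ln (real (k + 1))"
      using k by (intro mult_mono) auto
    ultimately show ?thesis unfolding E_def growth_exponent_def by simp
  qed
  have EW: "E \<le> real k * W"
  proof -
    have "ln (fact k / 4 :: real) \<le> ln (real k ^ k)"
    proof (subst ln_le_cancel_iff)
      have "(fact k :: real) / 4 \<le> fact k" by simp
      also have "\<dots> \<le> real k ^ k" using fact_le_power[of k, where ?'a = real] by simp
      finally show "(fact k :: real) / 4 \<le> real k ^ k" .
    qed (use k in auto)
    also have "\<dots> = real k * ln (real k)" using k by (simp add: ln_realpow)
    also have "\<dots> \<le> real k * L" using lk by (intro mult_left_mono) auto
    finally have "real k * ln (fact k / 4 :: real) \<le> real k * (real k * L)" by (intro mult_left_mono) auto
    moreover have "real (k + 1) * ln (real (k + 1)) \<le> real (k + 1) * L" using lk by (intro mult_left_mono) auto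
    ultimately have "E \<le> (real (k + 1) + real k * real k) * L"
      unfolding E_def growth_exponent_def by (simp add: algebra_simps)
    also have "\<dots> \<le> (real k * real (k + 2) * (4 / 3)) * L"
    proof (intro mult_right_mono)
      have "2 * 2 \<le> real k * real k" using k by (intro mult_mono) auto
      then show "real (k + 1) + real k * real k \<le> real k * real (k + 2) * (4 / 3)"
        by (simp add: algebra_simps)
    qed (use L in simp)
    also have "\<dots> = real k * (real (k + 2) * L * (4 / 3))" by (simp only: mult_ac)
    also have "\<dots> \<le> real k * W" using WL by (intro mult_left_mono) auto
    finally show ?thesis .
  qed
  have ElK: "E * lK \<le> v * W / 2"
  proof -
    have "E * lK \<le> (v / 3) * (3 / 2 * W)"
      using EW kW lKW lK0 E0 v0 by (intro mult_mono) auto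
    then show ?thesis by simp
  qed
  \<comment> \<open>The logarithmic form of the unsuitability of \<open>b\<close>.\<close>
  define T where "T = Y + lK"
  have key: "real b * ln (real n) + ln (fact b) \<le> T + real b * ln (fact k / 4)"
  proof -
    have "ln (real n ^ b * fact b) \<le> ln (H * real k ^ (2 * k + 2) * (fact k / 4) ^ b)"
      using bad nk H k by (subst ln_le_cancel_iff) auto
    moreover have "ln (real n ^ b * fact b) = real b * ln (real n) + ln (fact b)"
      using nk by (simp add: ln_mult ln_realpow)
    moreover have "ln (H * real k ^ (2 * k + 2) * (fact k / 4) ^ b) = T + real b * ln (fact k / 4)"
      using H k by (simp add: ln_mult ln_realpow T_def Y_def lK_def del: power_Suc of_nat_add of_nat_mult)
    ultimately show ?thesis by simp
  qed
  \<comment> \<open>If \<open>b > T / Z \<ge> Y / W\<close>, then \<open>ln b - c \<ge> Z\<close>, and \<open>b\<close> would be too large to be unsuitable.\<close>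
  have b_le: "real b \<le> T / Z"
  proof (rule ccontr)
    assume "\<not> real b \<le> T / Z"
    then have bT: "T / Z < real b" by simp
    have YW: "Y / W \<le> T / Z" using lK0 Y0 ZW Z2 unfolding T_def by (intro frac_le) auto
    have YW0: "0 < Y / W" using Y0 W7 by simp
    then have b0: "0 < real b" using YW bT by linarith
    have "ln (Y / W) \<le> ln (real b)" using YW bT YW0 by (subst ln_le_cancel_iff) auto
    then have "Z \<le> ln (real b) - c" using Y0 W7 ln_divide_pos[of Y W] by (simp add: Zc W_def[symmetric])
    then have "real b * Z \<le> real b * (ln (real b) - c)" using b0 by (intro mult_left_mono) auto
    moreover have "T < real b * Z" using bT Z2 by (simp add: divide_less_eq)
    moreover have "real b * (ln (real b) - c) \<le> T"
    proof -
      have "real b * ln 2 \<le> real b * ln (real n)" using lk by (intro mult_left_mono) auto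
      moreover have "real b * c = real b + real b * ln (fact k / 4) - real b * ln 2"
        unfolding c_def lM by (simp add: algebra_simps)
      ultimately show ?thesis using key ln_fact_ge[of b] by (simp add: right_diff_distrib)
    qed
    ultimately show False by linarith
  qed
  have a0: "0 < a" using a by simp
  have aq: "real a \<le> real b + q"
  proof -
    have "real a \<le> real (b + (fact k + 1))" using a(2) by (simp only: of_nat_le_iff)
    then show ?thesis by (simp add: q_def)
  qed
  have aY: "real a \<le> Y"
  proof -
    have "T / Z \<le> T / 2" using Z2 lK0 Y0 unfolding T_def by (intro frac_le) auto
    then have "real a \<le> (Y + lK) / 2 + q" using aq b_le unfolding T_def by linarith
    then show ?thesis using lKW qv Wv v7 v0 by argo
  qed
  have laW: "ln (real a) \<le> W" unfolding W_def using aY a0 Y0 by simp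
  have la0: "0 \<le> ln (real a)" using a0 by simp
  have lnU: "ln (2 * ?U) = ln 2 + (real (k * a + k) * ln (real n) + real ((k + 1) * a) * ln (real (k + 1))
      + real k * ln (fact a) + real (2 * k) * ln (real ((k + 1) * a + 2 * k)))"
    using nk a0 by (simp add: ln_mult ln_realpow del: of_nat_add of_nat_mult of_nat_Suc fact_Suc)
  have lfa: "ln (fact a :: real) \<le> ln (fact b) + q * ln (real a)"
  proof -
    have "(fact a :: nat) div fact (a - (a - b)) \<le> a ^ (a - b)" by (rule fact_div_fact_le_pow) simp
    moreover have "a - (a - b) = b" using a by simp
    moreover have "(fact b :: nat) dvd fact a" using a by (intro fact_dvd) simp
    ultimately have "(fact a :: nat) \<le> fact b * a ^ (a - b)"
      by (metis dvd_mult_div_cancel mult_le_mono2)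
    then have "real (fact a) \<le> real (fact b * a ^ (a - b))" by (simp only: of_nat_le_iff)
    then have "(fact a :: real) \<le> fact b * real a ^ (a - b)" by simp
    then have "ln (fact a :: real) \<le> ln (fact b * real a ^ (a - b))"
      using a0 by (subst ln_le_cancel_iff) auto
    also have "\<dots> = ln (fact b) + real (a - b) * ln (real a)"
      using a0 by (simp add: ln_mult ln_realpow)
    also have "\<dots> \<le> ln (fact b) + q * ln (real a)"
    proof -
      have "real (a - b) \<le> q" using aq a by (simp add: of_nat_diff)
      then show ?thesis using la0 by (intro add_left_mono mult_right_mono) auto
    qed
    finally show ?thesis .
  qed
  have t1: "real (k * a + k) * ln (real n) \<le> real k * (real b * ln (real n)) + v / 4"
  proof -
    have "real (k * a + k) * ln (real n) \<le> (real k * real b + real k * (q + 1)) * ln (real n)"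
    proof (intro mult_right_mono)
      have "real k * real a \<le> real k * (real b + q)" using aq by (intro mult_left_mono) auto
      then show "real (k * a + k) \<le> real k * real b + real k * (q + 1)" by (simp add: algebra_simps)
    qed (use lk in simp)
    moreover have "real k * (q + 1) * ln (real n) \<le> (real k * (4 / 3 * q)) * (3 / 16 * W)"
      using q3 lk LW by (intro mult_mono) auto
    ultimately show ?thesis by (simp add: v_def algebra_simps)
  qed
  have t2: "real ((k + 1) * a) * ln (real (k + 1)) \<le> real b * (real (k + 1) * ln (real (k + 1))) + 3 / 8 * v"
  proof -
    have "real ((k + 1) * a) * ln (real (k + 1)) = real a * (real (k + 1) * ln (real (k + 1)))"
      by (simp only: of_nat_mult mult_ac)
    also have "\<dots> \<le> (real b + q) * (real (k + 1) * ln (real (k + 1)))"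
      using aq by (intro mult_right_mono) auto
    also have "\<dots> = real b * (real (k + 1) * ln (real (k + 1))) + q * (real (k + 1) * ln (real (k + 1)))"
      by (rule distrib_right)
    also have "real (k + 1) * ln (real (k + 1)) \<le> real (k + 2) * L"
      using lk L by (intro mult_mono) auto
    then have "q * (real (k + 1) * ln (real (k + 1))) \<le> q * (3 / 4 * W)"
      using WL q3 by (intro mult_left_mono) auto
    finally show ?thesis using qW by simp
  qed
  have t3: "real (2 * k) * ln (real ((k + 1) * a + 2 * k)) \<le> 11 / 12 * v"
  proof -
    have "(k + 1) * a + 2 * k \<le> (k + 2)\<^sup>2 * a"
    proof -
      have "2 * k \<le> 2 * k * a" using a0 by simp
      then have "(k + 1) * a + 2 * k \<le> (k + 1) * a + 2 * k * a + (k * k + k + 3) * a"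
        by (intro trans_le_add1 add_left_mono)
      also have "\<dots> = (k + 2)\<^sup>2 * a"
        by (simp add: power2_eq_square algebra_simps)
      finally show ?thesis .
    qed
    then have "real ((k + 1) * a + 2 * k) \<le> real ((k + 2)\<^sup>2 * a)" by (simp only: of_nat_le_iff)
    then have "ln (real ((k + 1) * a + 2 * k)) \<le> ln (real ((k + 2)\<^sup>2 * a))"
      using a0 k by (subst ln_le_cancel_iff) (auto simp: add_pos_pos)
    also have "\<dots> = 2 * L + ln (real a)"
      using a0 by (simp add: ln_mult ln_realpow L_def del: of_nat_add)
    also have "\<dots> \<le> 11 / 8 * W" using LW laW by simp
    finally have "real (2 * k) * ln (real ((k + 1) * a + 2 * k)) \<le> real (2 * k) * (11 / 8 * W)"
      by (intro mult_left_mono) auto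
    also have "\<dots> = 11 / 4 * (real k * W)" by simp
    finally show ?thesis using kW by linarith
  qed
  have t4: "real k * ln (fact a) \<le> real k * ln (fact b) + v"
  proof -
    have "q * ln (real a) \<le> q * W" using laW q3 by (intro mult_left_mono) auto
    then have "real k * ln (fact a) \<le> real k * (ln (fact b) + q * W)"
      using lfa by (intro mult_left_mono) auto
    then show ?thesis by (simp add: v_def algebra_simps)
  qed
  have t5: "real k * (real b * ln (real n)) + real k * ln (fact b)
      \<le> real k * Y + v / 2 + real b * (real k * ln (fact k / 4))"
  proof -
    have "real k * (real b * ln (real n) + ln (fact b)) \<le> real k * (T + real b * ln (fact k / 4))"
      using key by (intro mult_left_mono) auto
    moreover have "real k * lK \<le> real k * (3 / 2 * W)" using lKW by (intro mult_left_mono) auto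
    ultimately show ?thesis using kW by (simp add: T_def algebra_simps)
  qed
  have t6: "ln (2 :: real) \<le> v / 42" using ln2_ge_two_thirds ln_2_less_1 W7 Wv by linarith
  have "ln (2 * ?U) \<le> real k * Y + real b * E + 7 / 2 * v"
  proof -
    have "real b * E = real b * (real (k + 1) * ln (real (k + 1))) + real b * (real k * ln (fact k / 4))"
      unfolding E_def growth_exponent_def by (rule distrib_left)
    then show ?thesis unfolding lnU using t1 t2 t3 t4 t5 t6 v0 by linarith
  qed
  also have "\<dots> \<le> real k * Y + omega_factor k / W * Y"
  proof -
    have "(E + 1) / Z \<le> omega_factor k / W"
      using main Z2 W7 by (simp add: field_simps)
    then have "(E + 1) / Z * Y \<le> omega_factor k / W * Y" using Y0 by (intro mult_right_mono) auto
    moreover have "real b * E + 7 / 2 * v \<le> (E + 1) / Z * Y"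
    proof -
      have "real b * E \<le> T / Z * E" using b_le E0 by (rule mult_right_mono)
      moreover have "T * E + 7 / 2 * v * Z \<le> (E + 1) * Y"
      proof -
        have "7 / 2 * v * Z \<le> 7 / 2 * v * W" using ZW v0 by (intro mult_left_mono) auto
        then show ?thesis using ElK vY by (simp add: T_def algebra_simps)
      qed
      ultimately show ?thesis using Z2 by (simp add: field_simps)
    qed
    ultimately show ?thesis by simp
  qed
  finally have "ln (2 * ?U) \<le> (real k + omega_factor k / W) * Y" by (simp add: algebra_simps)
  then have "exp (ln (2 * ?U)) \<le> exp ((real k + omega_factor k / W) * Y)" by simp
  moreover have "0 < 2 * ?U" using nk a0 by (intro mult_pos_pos zero_less_power) (auto simp: add_nonneg_pos add_pos_nonneg)
  ultimately show ?thesis by (simp only: exp_ln W_def Y_def)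
qed


lemma s_param_bounds:
  assumes "2 \<le> n" "2 \<le> k"
  shows "s_param 2 k \<le> s_param n k" "1 \<le> s_param 2 k"
proof -
  show "s_param 2 k \<le> s_param n k"
    unfolding s_param_def using assms by (intro mult_mono power_mono) auto
  have "ln (4::real) = 2 * ln 2" using ln_realpow[of 2 2] by simp
  then have "1 \<le> ln (4::real)" using ln2_ge_two_thirds by simp
  also have "ln 4 \<le> ln (real (k + 2))" using assms by simp
  finally have "1 \<le> (ln (real (k + 2)))\<^sup>2" by (rule one_le_power)
  then show "1 \<le> s_param 2 k" unfolding s_param_def using mult_mono[of 1 "real (k + 2)" 1 "(ln (real (k + 2)))\<^sup>2"] by simp
qed

theorem theorem1:
  fixes k n :: nat and H r :: real and l :: "nat \<Rightarrow> int"
  assumes "2 \<le> n" and "n \<le> k"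
    and "1 \<le> H"
    and "ln H \<ge> s_param n k * exp (s_param n k)"
    and "r > omega k H"
    and "\<exists>i\<in>{0..k}. l i \<noteq> 0"
    and "Max ((\<lambda>i. \<bar>real_of_int (l i)\<bar>) ` {1..k}) \<le> H"
  shows "\<bar>\<Sum>i=0..k. real_of_int (l i) * exp (real i / real n)\<bar> > 1 / (H powr r)"
proof -
  let ?s = "s_param n k"
  have k: "2 \<le> k" using assms(1,2) by simp
  have s: "s_param 2 k \<le> ?s" "1 \<le> s_param 2 k" using s_param_bounds[OF assms(1) k] by auto
  have "1 * exp ?s \<le> ?s * exp ?s" using s by (intro mult_right_mono) auto
  then have lnH: "exp ?s \<le> ln H" using assms(4) by linarith
  moreover have "1 < exp ?s" using s by simp
  ultimately have Y: "1 < ln H" by linarith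
  then have H1: "1 < H" using assms(3) by (metis ln_one not_less_iff_gr_or_eq order_le_less zero_less_one not_one_less_zero order_less_trans)
  have "?s \<le> ln (ln H)" using lnH Y by (subst ln_ge_iff) auto
  then have W: "s_param 2 k \<le> ln (ln H)" using s by linarith
  have n0: "0 < n" and q0: "0 < (fact k + 1 :: nat)"
    using assms(1) by auto
  have C1: "1 < H * real k ^ (2 * k + 2)"
    using H1 k by (intro less_1_mult one_less_power) auto
  obtain a b where a: "b < a" "a \<le> b + (fact k + 1)" "fact k + 1 dvd a + 1"
    and bad: "real n ^ b * fact b < H * real k ^ (2 * k + 2) * (fact k / 4) ^ b"
    and good: "H * real k ^ (2 * k + 2) * (fact k / 4) ^ a \<le> real n ^ a * fact a"
    using exponent_choice[OF n0 C1 q0, where M = "fact k / 4"] by blast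
  have bound: "\<bar>real_of_int (l i)\<bar> \<le> H" if "1 \<le> i" "i \<le> k" for i
    using assms(7) that by (subst (asm) Max_le_iff) auto
  obtain i0 where i0: "i0 \<le> k" "l i0 \<noteq> 0" using assms(6) by auto
  define U where "U = real n ^ (k * a + k) * real (k + 1) ^ ((k + 1) * a) * fact a ^ k
              * real ((k + 1) * a + 2 * k) ^ (2 * k)"
  define \<Lambda> where "\<Lambda> = (\<Sum>i\<le>k. real_of_int (l i) * exp (real i / real n))"
  have "omega k H = real k + omega_factor k / ln (ln H)"
    unfolding omega_def omega_factor_def by simp
  then have "2 * U \<le> exp (omega k H * ln H)"
    using final_estimate[OF assms(1,2) H1 Y W a(1,2) bad] unfolding U_def by simp
  also have "\<dots> < exp (r * ln H)" using assms(5) Y by simp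
  also have "\<dots> = H powr r" using H1 by (simp add: powr_def)
  finally have U: "2 * U < H powr r" .
  have H0: "0 \<le> H" using H1 by simp
  have one: "1 \<le> 2 * U * \<bar>\<Lambda>\<bar>"
    unfolding U_def \<Lambda>_def
    by (rule linear_form_lower_bound[where l = l and ?i0.0 = i0, OF assms(1,2) a(3) good H0 _ i0])
      (rule bound)
  then have "\<Lambda> \<noteq> 0" by auto
  then have "2 * U * \<bar>\<Lambda>\<bar> < H powr r * \<bar>\<Lambda>\<bar>" using U by (intro mult_strict_right_mono) auto
  then have "1 < H powr r * \<bar>\<Lambda>\<bar>" using one by linarith
  then have "1 / H powr r < \<bar>\<Lambda>\<bar>" using H1 by (simp add: divide_less_eq mult.commute)
  then show ?thesis unfolding \<Lambda>_def atMost_atLeast0 .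
qed

end
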